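(* Let $(p_k)_{k\ge 0}$ be a bounded sequence of integers with $p_k\ge 2$ (the cutting parameter), and let $(t_k)_{k\ge1}$ and $x=(x_{k,p_k})_{k\ge 1}$ be sequences of positive integers. Let $(h_k)_{k\ge1}$ be the heights determined by these data as in the context, and assume that $2t_k\le h_k$ for all $k\ge1$, that $\sum_{k=1}^{\infty}\frac{t_k}{h_k}<\infty$, and that $x$ is admissible, i.e. $\sum_{k=1}^{\infty}\frac{x_{k,p_k}}{p_kh_k}<\infty$. Let $(\Omega,\mathcal A,\mathbb P)$ be the associated probability space of Ornstein transformations $T_{\omega,x}$, $\omega\in\Omega$, defined in the context. Then $\mathbb P(\mathcal{WMIX})=1$, where $\mathcal{WMIX}$ is the set of $\omega\in\Omega$ for which $T_{\omega,x}$ is weakly mixing; that is, for $\mathbb P$-almost every $\omega$ the transformation $T_{\omega,x}$ is weakly mixing.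
   Context: **Rank one transformations by cutting and stacking.** Given integers $p_k\ge2$ ($k\ge0$) and non-negative integers $a_j^{(k)}$ ($k\ge 0$, $1\le j\le p_k$), start with the unit interval $B_0$ with Lebesgue measure, viewed as a stack of height $h_0=1$. At the $k$-th stage ($k\ge1$), the stack of height $h_{k-1}$ obtained at the previous stage (consisting of $h_{k-1}$ disjoint intervals of equal length, called levels, where each non-top level is mapped by translation onto the level directly above it) is divided into $p_{k-1}$ columns of equal width. Above the $j$-th column one puts $a_j^{(k-1)}$ spacers (new disjoint intervals of the same width as the column), for $1\le j\le p_{k-1}$. The columns are then stacked, the $(j+1)$-st column with its spacers on top of the $j$-th column with its spacers, giving a new stack of height $h_k=p_{k-1}h_{k-1}+\sum_{j=1}^{p_{k-1}}a_j^{(k-1)}$. On each stack the transformation maps each point of a non-top level to the point directly above it. These partial maps extend one another, and in the limit they define an invertible measure preserving transformation $T$ (up to null sets) of the measure space $(X,\mathcal B,\nu)$, where $X$ is the union of all levels of all stacks and $\nu$ is Lebesgue measure. **Random spacers.** The step from the stack of height $h_0=1$ to the stack of height $h_1$ uses fixed (deterministic) non-negative integers $a_j^{(0)}$, $1\le j\le p_0$. For $k\ge1$ let $X_k=\{-t_k,-t_k+1,\dots,t_k\}$. The numbers $x_{k,i}$, $1\le i\le p_k-1$, are chosen independently and uniformly in $X_k$ (independently also for different $k$), while $x_{k,p_k}$ is the given deterministic positive integer, and $x_{k,0}=0$. Set $$a_i^{(k)}=2t_k+x_{k,i}-x_{k,i-1},\qquad 1\le i\le p_k .$$ These are non-negative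 integers, and $h_{k+1}=p_k(h_k+2t_k)+x_{k,p_k}$ for $k\ge 1$, so the heights $h_k$ are deterministic. Formally, $\Omega=\prod_{k=1}^\infty X_k^{p_k-1}$ is equipped with the product $\sigma$-algebra $\mathcal A$ and the product probability $\mathbb P=\bigotimes_{k=1}^\infty\bigotimes_{l=1}^{p_k-1}\mathcal U_k$, where $\mathcal U_k$ is the uniform probability on $X_k$; the coordinates of $\omega\in\Omega$ are the $x_{k,i}(\omega)$, $k\ge1$, $1\le i\le p_k-1$. For $\omega\in\Omega$, $T_{\omega,x}$ denotes the rank one transformation constructed with cutting parameter $(p_k)$ and spacers $a_i^{(k)}=a_i^{(k)}(\omega)$. The summability conditions guarantee that the total measure $\nu(X)$ is finite, and $\nu$ is normalized to a probability measure. **Weak mixing.** A measure preserving transformation $T$ of a probability space is weakly mixing if its only eigenvalue (for the operator $f\mapsto f\circ T$ on $L^2$) is $1$ and the corresponding eigenfunctions are almost everywhere constant. *)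

theory Defs
  imports "HOL-Probability.Probability"
begin

section \<open>Weak mixing\<close>

definition measure_preserving_map :: "'a measure \<Rightarrow> ('a \<Rightarrow> 'a) \<Rightarrow> bool" where
  "measure_preserving_map M T \<longleftrightarrow> T \<in> measurable M M \<and> distr M M T = M"

text \<open>Eigenfunctions of the Koopman operator on complex \<open>L\<^sup>2\<close>, written on representatives: nonzero
  in \<open>L\<^sup>2\<close> means not almost everywhere zero.\<close>

definition koopman_eigenfunction ::
    "'a measure \<Rightarrow> ('a \<Rightarrow> 'a) \<Rightarrow> complex \<Rightarrow> ('a \<Rightarrow> complex) \<Rightarrow> bool" where
  "koopman_eigenfunction M T l f \<longleftrightarrow>
     f \<in> borel_measurable M \<and> integrable M (\<lambda>x. (cmod (f x))\<^sup>2) \<and>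
     \<not> (AE x in M. f x = 0) \<and> (AE x in M. f (T x) = l * f x)"

definition koopman_eigenvalue :: "'a measure \<Rightarrow> ('a \<Rightarrow> 'a) \<Rightarrow> complex \<Rightarrow> bool" where
  "koopman_eigenvalue M T l \<longleftrightarrow> (\<exists>f. koopman_eigenfunction M T l f)"

definition weakly_mixing :: "'a measure \<Rightarrow> ('a \<Rightarrow> 'a) \<Rightarrow> bool" where
  "weakly_mixing M T \<longleftrightarrow>
     prob_space M \<and> measure_preserving_map M T \<and>
     {l. koopman_eigenvalue M T l} = {1} \<and>
     (\<forall>f. koopman_eigenfunction M T 1 f \<longrightarrow> (\<exists>c. AE x in M. f x = c))"


section \<open>Rank one transformations by cutting and stacking\<close>

text \<open>The cutting parameter is \<open>p\<close>; \<open>a k j\<close> for \<open>1 \<le> j \<le> p k\<close> is the number of spacers put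
  above the \<open>j\<close>-th column when stack \<open>k + 1\<close> is built from stack \<open>k\<close>. Levels are half-open
  intervals of length \<open>level_width p k\<close>, and a stack is the list of the left endpoints of its
  levels, from bottom to top.\<close>

definition level_width :: "(nat \<Rightarrow> nat) \<Rightarrow> nat \<Rightarrow> real" where
  "level_width p k = 1 / (\<Prod>i<k. real (p i))"

text \<open>The levels of stack \<open>k\<close> fill an initial interval of the half-line starting at 0. The new
  spacers are taken from the line one after the other, to the right of this interval.\<close>

primrec stack :: "(nat \<Rightarrow> nat) \<Rightarrow> (nat \<Rightarrow> nat \<Rightarrow> nat) \<Rightarrow> nat \<Rightarrow> real list" where
  "stack p a 0 = [0]"
| "stack p a (Suc k) =
     concat (map (\<lambda>j.
         map (\<lambda>b. b + real (j - 1) * level_width p (Suc k)) (stack p a k)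
       @ map (\<lambda>s. real (length (stack p a k)) * level_width p k
                + real ((\<Sum>i=1..<j. a k i) + s) * level_width p (Suc k)) [0..<a k j])
       [1..<Suc (p k)])"

definition level :: "(nat \<Rightarrow> nat) \<Rightarrow> (nat \<Rightarrow> nat \<Rightarrow> nat) \<Rightarrow> nat \<Rightarrow> nat \<Rightarrow> real set" where
  "level p a k i = {stack p a k ! i ..< stack p a k ! i + level_width p k}"

definition rank_one_set :: "(nat \<Rightarrow> nat) \<Rightarrow> (nat \<Rightarrow> nat \<Rightarrow> nat) \<Rightarrow> real set" where
  "rank_one_set p a = (\<Union>k. \<Union>i<length (stack p a k). level p a k i)"

text \<open>Normalized Lebesgue measure.\<close>

definition rank_one_measure :: "(nat \<Rightarrow> nat) \<Rightarrow> (nat \<Rightarrow> nat \<Rightarrow> nat) \<Rightarrow> real measure" where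
  "rank_one_measure p a =
     uniform_measure (restrict_space lborel (rank_one_set p a)) (rank_one_set p a)"

text \<open>\<open>rank_one_step p a y z\<close>: in some stack, \<open>z\<close> is the point directly above \<open>y\<close>. The relation is
  single-valued, because the partial maps given by the stacks extend one another. The points
  of \<open>rank_one_set p a\<close> without successor lie in the top level of every large stack, so they form a null set;
  the transformation is the identity there.\<close>

definition rank_one_step ::
    "(nat \<Rightarrow> nat) \<Rightarrow> (nat \<Rightarrow> nat \<Rightarrow> nat) \<Rightarrow> real \<Rightarrow> real \<Rightarrow> bool" where
  "rank_one_step p a y z \<longleftrightarrow>
     (\<exists>k i. Suc i < length (stack p a k) \<and> y \<in> level p a k i \<and>
            z = y - stack p a k ! i + stack p a k ! Suc i)"

definition rank_one_map :: "(nat \<Rightarrow> nat) \<Rightarrow> (nat \<Rightarrow> nat \<Rightarrow> nat) \<Rightarrow> real \<Rightarrow> real" where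
  "rank_one_map p a y =
     (if \<exists>z. rank_one_step p a y z then THE z. rank_one_step p a y z else y)"


section \<open>Ornstein transformations\<close>

text \<open>\<open>a0 j\<close> for \<open>1 \<le> j \<le> p 0\<close> are the deterministic spacers of the first step, and \<open>x k\<close> is
  the deterministic last coordinate \<open>x\<^bsub>k,p\<^sub>k\<^esub>\<close>. Of \<open>t\<close> and \<open>x\<close> only the values at \<open>k \<ge> 1\<close> are used.\<close>

fun ornstein_height ::
    "(nat \<Rightarrow> nat) \<Rightarrow> (nat \<Rightarrow> nat) \<Rightarrow> (nat \<Rightarrow> nat) \<Rightarrow> (nat \<Rightarrow> nat) \<Rightarrow> nat \<Rightarrow> nat" where
  "ornstein_height p a0 t x 0 = 1"
| "ornstein_height p a0 t x (Suc 0) = p 0 + (\<Sum>j=1..p 0. a0 j)"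
| "ornstein_height p a0 t x (Suc (Suc k)) =
     p (Suc k) * (ornstein_height p a0 t x (Suc k) + 2 * t (Suc k)) + x (Suc k)"

definition ornstein_space :: "(nat \<Rightarrow> nat) \<Rightarrow> (nat \<Rightarrow> nat) \<Rightarrow> (nat \<Rightarrow> nat \<Rightarrow> int) measure" where
  "ornstein_space p t =
     (\<Pi>\<^sub>M k\<in>{1..}. \<Pi>\<^sub>M l\<in>{1..p k - 1}. uniform_count_measure {- int (t k)..int (t k)})"

definition ornstein_coord ::
    "(nat \<Rightarrow> nat) \<Rightarrow> (nat \<Rightarrow> nat) \<Rightarrow> (nat \<Rightarrow> nat \<Rightarrow> int) \<Rightarrow> nat \<Rightarrow> nat \<Rightarrow> int" where
  "ornstein_coord p x \<omega> k i =
     (if i = 0 then 0 else if i = p k then int (x k) else \<omega> k i)"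

text \<open>For \<open>\<omega>\<close> in the space and \<open>1 \<le> i \<le> p k\<close> the argument of \<open>nat\<close> is nonnegative.\<close>

definition ornstein_spacers ::
    "(nat \<Rightarrow> nat) \<Rightarrow> (nat \<Rightarrow> nat) \<Rightarrow> (nat \<Rightarrow> nat) \<Rightarrow> (nat \<Rightarrow> nat) \<Rightarrow> (nat \<Rightarrow> nat \<Rightarrow> int)
      \<Rightarrow> nat \<Rightarrow> nat \<Rightarrow> nat" where
  "ornstein_spacers p a0 t x \<omega> k i =
     (if k = 0 then a0 i
      else nat (2 * int (t k) + ornstein_coord p x \<omega> k i - ornstein_coord p x \<omega> k (i - 1)))"

text \<open>The recursion for the heights agrees with the actual stacks.\<close>

lemma length_stack_Suc:
  "length (stack p a (Suc k)) = p k * length (stack p a k) + (\<Sum>j=1..p k. a k j)"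
proof -
  have "length (stack p a (Suc k)) = (\<Sum>j\<leftarrow>[1..<Suc (p k)]. length (stack p a k) + a k j)"
    by (simp add: length_concat o_def)
  also have "\<dots> = (\<Sum>j\<in>{1..p k}. length (stack p a k) + a k j)"
    unfolding interv_sum_list_conv_sum_set_nat by (simp only: set_upt atLeastLessThanSuc_atLeastAtMost)
  finally show ?thesis
    by (simp add: sum.distrib)
qed

lemma ornstein_space_bound:
  assumes "\<omega> \<in> space (ornstein_space p t)" "1 \<le> k" "1 \<le> i" "i \<le> p k - 1"
  shows "\<omega> k i \<in> {- int (t k)..int (t k)}"
proof -
  have "\<omega> k \<in> space (\<Pi>\<^sub>M l\<in>{1..p k - 1}. uniform_count_measure {- int (t k)..int (t k)})"
    using assms unfolding ornstein_space_def by (auto simp: space_PiM)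
  then show ?thesis
    using assms by (auto simp: space_PiM space_uniform_count_measure dest!: PiE_mem[where x = i])
qed

lemma ornstein_spacers_int:
  assumes "\<omega> \<in> space (ornstein_space p t)" "1 \<le> k" "1 \<le> i" "i \<le> p k"
  shows "int (ornstein_spacers p a0 t x \<omega> k i) =
    2 * int (t k) + ornstein_coord p x \<omega> k i - ornstein_coord p x \<omega> k (i - 1)"
proof -
  have "ornstein_coord p x \<omega> k i \<ge> - int (t k)"
    using ornstein_space_bound[OF assms(1,2), of i] assms by (auto simp: ornstein_coord_def)
  moreover have "ornstein_coord p x \<omega> k (i - 1) \<le> int (t k)"
    using ornstein_space_bound[OF assms(1,2), of "i - 1"] assms by (auto simp: ornstein_coord_def)
  ultimately show ?thesis
    using assms by (simp add: ornstein_spacers_def)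
qed

lemma length_stack_ornstein:
  assumes "\<And>k. p k \<ge> 2" "\<omega> \<in> space (ornstein_space p t)"
  shows "length (stack p (ornstein_spacers p a0 t x \<omega>) k) = ornstein_height p a0 t x k"
proof (induction k)
  case 0
  show ?case by simp
next
  case (Suc k)
  let ?a = "ornstein_spacers p a0 t x \<omega>"
  show ?case
  proof (cases k)
    case 0
    then show ?thesis
      by (simp add: length_stack_Suc ornstein_spacers_def del: stack.simps(2))
  next
    case (Suc m)
    let ?c = "ornstein_coord p x \<omega> k"
    have "int (\<Sum>j=1..p k. ?a k j) = (\<Sum>j=1..p k. 2 * int (t k) + (?c j - ?c (j - 1)))"
      using Suc assms(2) by (simp add: ornstein_spacers_int add_diff_eq)
    also have "\<dots> = int (p k) * (2 * int (t k)) + (\<Sum>j=Suc 0..p k. ?c j - ?c (j - 1))"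
      by (simp add: sum.distrib)
    also have "(\<Sum>j=Suc 0..p k. ?c j - ?c (j - 1)) = ?c (p k) - ?c 0"
      by (rule sum_telescope'') simp
    also have "\<dots> = int (x k)"
      using assms(1)[of k] by (simp add: ornstein_coord_def)
    finally have "(\<Sum>j=1..p k. ?a k j) = p k * (2 * t k) + x k"
      by (metis (mono_tags, lifting) of_nat_add of_nat_eq_iff of_nat_mult of_nat_numeral)
    then show ?thesis
      using Suc.IH Suc by (simp add: length_stack_Suc algebra_simps del: stack.simps(2))
  qed
qed

end

theory Submission
  imports Defs
begin

text \<open>
Let \<open>l\<close> be an eigenvalue with eigenfunction \<open>f\<close>. The transformation moves the levels of a stack by
translation and multiplies \<open>f\<close> by \<open>l\<close>, so on the stack of height \<open>h\<^sub>k\<close> the function \<open>f\<close> is determined by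
its restriction to the bottom level. Approximating \<open>f\<close> in \<open>L\<^sup>1\<close> by functions that are constant on
levels shows that this restriction is nearly constant, with an error that is small compared to the
measure of one level (\<open>base_almost_constant\<close>). For \<open>l = 1\<close> it follows that \<open>f\<close> is constant
(\<open>invariant_constant\<close>). For general \<open>l\<close>, compare the first two columns of the bottom level: the first
one is carried onto the second one by \<open>m\<^sub>k = h\<^sub>k + a\<^sub>1\<^bsup>(k)\<^esup>\<close> steps. Since both carry the same share of the
norm of \<open>f\<close>, which is bounded below because \<open>h\<^bsub>k+1\<^esub> / h\<^sub>k\<close> is bounded, \<open>l ^ m\<^sub>k\<close> tends to 1
(\<open>eigenvalue_power_tendsto_1\<close>).

It remains to exclude, almost surely, every \<open>l = exp (2 \<pi> i \<theta>)\<close> other than 1 with \<open>l ^ m\<^sub>k\<close> tending to 1.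
For a fixed \<open>\<theta>\<close> this is easy, since \<open>m\<^sub>k = h\<^sub>k + 2 t\<^sub>k + x\<^sub>k\<^sub>,\<^sub>1\<close> with \<open>x\<^sub>k\<^sub>,\<^sub>1\<close> uniform on at least three
consecutive integers, but there are uncountably many \<open>\<theta>\<close>. Here the bounded growth of \<open>h\<^sub>k\<close> helps: if
\<open>\<theta> m\<^sub>k\<close> is within \<open>e\<close> of a known integer, then \<open>\<theta>\<close> lies in a known interval of length \<open>2 e / h\<^sub>k\<close>, and those
\<open>\<theta>\<close> in this interval for which \<open>\<theta> m\<^bsub>k+1\<^esub>\<close> is again within \<open>e\<close> of an integer lie in a single interval of
length \<open>2 e / h\<^bsub>k+1\<^esub>\<close> (\<open>tight_step\<close>). Two neighbouring values of \<open>x\<^bsub>k+1,1\<^esub>\<close> cannot both be compatible with such an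
interval when it stays away from the integers, so at most \<open>t + 1\<close> of the \<open>2 t + 1\<close> values are
(\<open>few_survivors_step\<close>). Hence in each of countably many starting intervals some \<open>\<theta>\<close> survives \<open>n\<close>
stages with probability at most \<open>(2 / 3) ^ n\<close>.
\<close>


section \<open>Stacks and the transformation\<close>

declare stack.simps(2) [simp del]

locale cutting_and_stacking =
  fixes p :: "nat \<Rightarrow> nat" and a :: "nat \<Rightarrow> nat \<Rightarrow> nat"
  assumes two_le_p: "2 \<le> p k"
begin

abbreviation "S \<equiv> stack p a"
abbreviation "H k \<equiv> length (S k)"
abbreviation "w \<equiv> level_width p"
abbreviation "L \<equiv> level p a"
abbreviation "T \<equiv> rank_one_map p a"
abbreviation "X \<equiv> rank_one_set p a"
abbreviation "\<mu> \<equiv> rank_one_measure p a"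

lemma p_pos: "0 < p k"
  using two_le_p[of k] by linarith

lemma width_pos: "0 < w k"
  unfolding level_width_def using p_pos by (simp add: prod_pos)

lemma width_nonneg: "0 \<le> w k"
  using width_pos[of k] by simp

lemma width_Suc: "w k = real (p k) * w (Suc k)"
  unfolding level_width_def using p_pos[of k] by simp

lemma width_0: "w 0 = 1"
  by (simp add: level_width_def)

lemma width_tendsto_0: "w \<longlonglongrightarrow> 0"
proof -
  have "w k \<le> (1/2)^k" for k
  proof (induction k)
    case 0 show ?case by (simp add: width_0)
  next
    case (Suc k)
    have "2 * w (Suc k) \<le> real (p k) * w (Suc k)"
      using two_le_p[of k] by (intro mult_right_mono) (auto simp: width_nonneg)
    then show ?case using Suc width_Suc[of k] by simp
  qed
  moreover have "(\<lambda>k. (1/2)^k :: real) \<longlonglongrightarrow> 0"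
    by (intro LIMSEQ_power_zero) auto
  ultimately show ?thesis
    by (intro tendsto_sandwich[of "\<lambda>_. 0" w sequentially "\<lambda>k. (1/2)^k"])
      (auto simp: width_nonneg)
qed

text \<open>Every column of a stack inside the next one is a translated copy of the stack.\<close>

lemma stack_Suc_column:
  assumes "1 \<le> j" "j \<le> p k"
  obtains pre post where
    "S (Suc k) = pre @ map (\<lambda>b. b + real (j - 1) * w (Suc k)) (S k) @ post"
    "length pre = (\<Sum>i=1..<j. H k + a k i)"
proof -
  define f where "f j = map (\<lambda>b. b + real (j - 1) * w (Suc k)) (S k)
       @ map (\<lambda>s. real (H k) * w k + real ((\<Sum>i=1..<j. a k i) + s) * w (Suc k)) [0..<a k j]" for j
  have split: "[1..<Suc (p k)] = [1..<j] @ j # [Suc j..<Suc (p k)]"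
    using assms upt_add_eq_append[of 1 j "Suc (p k) - j"] by (simp add: upt_conv_Cons del: upt_Suc)
  have "S (Suc k) = concat (map f [1..<j]) @ f j @ concat (map f [Suc j..<Suc (p k)])"
    unfolding stack.simps(2) f_def[symmetric] split by simp
  moreover have "length (concat (map f [1..<j])) = (\<Sum>i=1..<j. H k + a k i)"
    by (simp add: length_concat o_def f_def interv_sum_list_conv_sum_set_nat)
  ultimately show thesis
    by (intro that[of "concat (map f [1..<j])"
      "map (\<lambda>s. real (H k) * w k + real ((\<Sum>i=1..<j. a k i) + s) * w (Suc k)) [0..<a k j]
        @ concat (map f [Suc j..<Suc (p k)])"]) (simp_all add: f_def)
qed

lemma height_pos: "0 < H k"
proof (induction k)
  case 0 show ?case by simp
next
  case (Suc k)
  then show ?case using p_pos[of k] by (simp add: length_stack_Suc)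
qed

lemma stack_bottom: "S k ! 0 = 0"
proof (induction k)
  case 0 show ?case by simp
next
  case (Suc k)
  obtain post where "S (Suc k) = map (\<lambda>b. b + real (1 - 1) * w (Suc k)) (S k) @ post"
    using stack_Suc_column[of 1 k] p_pos[of k] by auto
  then show ?case using Suc height_pos[of k] by (simp add: nth_append)
qed

text \<open>The second column sits exactly \<open>H k + a k 1\<close> levels above the first one, so this is
  the return time that carries the first column of the bottom level onto the second.\<close>

lemma stack_second_column: "H k + a k 1 < H (Suc k)" "S (Suc k) ! (H k + a k 1) = w (Suc k)"
proof -
  obtain pre post where *: "S (Suc k) = pre @ map (\<lambda>b. b + real (2 - 1) * w (Suc k)) (S k) @ post"
    "length pre = (\<Sum>i=1..<2. H k + a k i)"
    using stack_Suc_column[of 2 k] two_le_p[of k] by auto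
  have l: "length pre = H k + a k 1"
    using *(2) by (simp add: numeral_2_eq_2)
  show "H k + a k 1 < H (Suc k)"
    using *(1) l height_pos[of k] by simp
  show "S (Suc k) ! (H k + a k 1) = w (Suc k)"
    using *(1) l height_pos[of k] stack_bottom[of k] by (simp add: nth_append)
qed

text \<open>Numbering the spacers column after column enumerates an initial segment of the integers without
  gaps.\<close>

lemma spacers_enumerate:
  fixes A :: "nat \<Rightarrow> nat"
  shows "(\<Union>j\<in>{1..q}. (\<lambda>s. (\<Sum>i=1..<j. A i) + s) ` {..<A j}) = {..<\<Sum>i=1..q. A i}"
proof (induction q)
  case 0 show ?case by simp
next
  case (Suc q)
  have "{1..Suc q} = insert (Suc q) {1..q}" by auto
  then have "(\<Union>j\<in>{1..Suc q}. (\<lambda>s. (\<Sum>i=1..<j. A i) + s) ` {..<A j}) =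
    (\<lambda>s. (\<Sum>i=1..q. A i) + s) ` {..<A (Suc q)} \<union> {..<\<Sum>i=1..q. A i}"
    using Suc.IH by (simp add: atLeastLessThanSuc_atLeastAtMost)
  also have "(\<lambda>s. (\<Sum>i=1..q. A i) + s) ` {..<A (Suc q)} =
    {(\<Sum>i=1..q. A i)..<(\<Sum>i=1..q. A i) + A (Suc q)}"
    by (simp add: lessThan_atLeast0 add.commute)
  also have "\<dots> \<union> {..<\<Sum>i=1..q. A i} = {..<\<Sum>i=1..Suc q. A i}"
    by auto
  finally show ?case .
qed

text \<open>As sets, stacks are very simple: new spacers are appended to the right of the old levels, and both
  have lengths that are multiples of the new width. So the levels are the cells of a grid, and only their
  order in the stack is complicated. All disjointness and measure computations rest on this.\<close>

lemma set_stack: "set (S k) = (\<lambda>n. real n * w k) ` {..<H k}"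
proof (induction k)
  case 0 show ?case by (auto simp: lessThan_Suc)
next
  case (Suc k)
  have grid: "real n * w k + real r * w (Suc k) = real (n * p k + r) * w (Suc k)" for n r
    using width_Suc[of k] by (simp add: algebra_simps)
  have "set (S (Suc k)) =
    (\<Union>j\<in>{1..p k}. (\<lambda>b. b + real (j - 1) * w (Suc k)) ` set (S k)) \<union>
    (\<Union>j\<in>{1..p k}. (\<lambda>s. real (H k) * w k + real ((\<Sum>i=1..<j. a k i) + s) * w (Suc k)) ` {..<a k j})"
    unfolding stack.simps(2)
    by (simp add: image_Un UN_Un_distrib atLeastLessThanSuc_atLeastAtMost lessThan_atLeast0
        del: upt_Suc)
  also have "(\<Union>j\<in>{1..p k}. (\<lambda>b. b + real (j - 1) * w (Suc k)) ` set (S k)) =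
     (\<lambda>n. real n * w (Suc k)) ` (\<Union>j\<in>{1..p k}. (\<lambda>n. n * p k + (j - 1)) ` {..<H k})"
    unfolding Suc.IH image_image image_UN grid ..
  also have "(\<Union>j\<in>{1..p k}. (\<lambda>n. n * p k + (j - 1)) ` {..<H k}) = {..<H k * p k}"
  proof (intro set_eqI iffI)
    fix m assume "m \<in> (\<Union>j\<in>{1..p k}. (\<lambda>n. n * p k + (j - 1)) ` {..<H k})"
    then obtain j n where m: "m = n * p k + (j - 1)" and j: "1 \<le> j" "j \<le> p k" and n: "n < H k"
      by auto
    have "m < Suc n * p k" using j m by simp
    also have "\<dots> \<le> H k * p k" using n by (intro mult_right_mono) auto
    finally show "m \<in> {..<H k * p k}" by simp
  next
    fix m assume "m \<in> {..<H k * p k}"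
    then have "m div p k < H k" by (simp add: less_mult_imp_div_less)
    moreover have "m = (m div p k) * p k + (Suc (m mod p k) - 1)" by simp
    moreover have "Suc (m mod p k) \<in> {1..p k}" using p_pos[of k] by (simp add: Suc_le_eq)
    ultimately show "m \<in> (\<Union>j\<in>{1..p k}. (\<lambda>n. n * p k + (j - 1)) ` {..<H k})"
      by blast
  qed
  also have "(\<Union>j\<in>{1..p k}. (\<lambda>s. real (H k) * w k + real ((\<Sum>i=1..<j. a k i) + s) * w (Suc k)) ` {..<a k j})
    = (\<lambda>n. real n * w (Suc k)) ` (\<lambda>r. H k * p k + r) `
       (\<Union>j\<in>{1..p k}. (\<lambda>s. (\<Sum>i=1..<j. a k i) + s) ` {..<a k j})"
    unfolding image_image image_UN grid ..
  also have "(\<lambda>r. H k * p k + r) ` (\<Union>j\<in>{1..p k}. (\<lambda>s. (\<Sum>i=1..<j. a k i) + s) ` {..<a k j}) =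
    {H k * p k..<H (Suc k)}"
    unfolding spacers_enumerate
    by (simp add: lessThan_atLeast0 length_stack_Suc mult.commute image_add_atLeastLessThan' add.commute)
  also have "(\<lambda>n. real n * w (Suc k)) ` {..<H k * p k} \<union> (\<lambda>n. real n * w (Suc k)) ` {H k * p k..<H (Suc k)} =
     (\<lambda>n. real n * w (Suc k)) ` {..<H (Suc k)}"
    unfolding image_Un[symmetric] by (intro arg_cong[where f="image _"]) (auto simp: length_stack_Suc mult.commute)
  finally show ?case .
qed

lemma inj_grid: "inj_on (\<lambda>n. real n * w k) A"
  using width_pos[of k] by (auto simp: inj_on_def)

lemma distinct_stack: "distinct (S k)"
  by (rule card_distinct) (simp add: set_stack card_image inj_grid)

lemma stack_nth_grid:
  assumes "i < H k"
  obtains n where "n < H k" "S k ! i = real n * w k"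
  using nth_mem[OF assms] unfolding set_stack by auto

lemma mem_level: "y \<in> L k i \<longleftrightarrow> S k ! i \<le> y \<and> y < S k ! i + w k"
  by (auto simp: level_def)

lemma floor_on_level:
  assumes "i < H k" "y \<in> L k i"
  shows "S k ! i = of_int \<lfloor>y / w k\<rfloor> * w k"
proof -
  obtain n where n: "S k ! i = real n * w k" using stack_nth_grid[OF assms(1)] .
  have "\<lfloor>y / w k\<rfloor> = int n"
    using assms(2) width_pos[of k] unfolding mem_level n
    by (intro floor_unique) (auto simp: field_simps)
  then show ?thesis using n by simp
qed

lemma level_disjoint:
  assumes "i < H k" "i' < H k" "y \<in> L k i" "y \<in> L k i'"
  shows "i = i'"
  using floor_on_level[OF assms(1,3)] floor_on_level[OF assms(2,4)] distinct_stack[of k] assms(1,2)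
  by (metis nth_eq_iff_index_eq)

lemma tower_eq: "(\<Union>i<H k. L k i) = {0..<real (H k) * w k}"
proof (intro set_eqI iffI)
  fix y assume "y \<in> (\<Union>i<H k. L k i)"
  then obtain i where i: "i < H k" "y \<in> L k i" by auto
  obtain n where n: "n < H k" "S k ! i = real n * w k" using stack_nth_grid[OF i(1)] .
  have "real (Suc n) * w k \<le> real (H k) * w k"
    using n width_pos[of k] by (intro mult_right_mono) auto
  moreover have "0 \<le> S k ! i" unfolding n(2) by (simp add: width_nonneg)
  then have "0 \<le> y" using i(2) by (simp add: mem_level)
  ultimately show "y \<in> {0..<real (H k) * w k}"
    using i n by (auto simp: mem_level algebra_simps)
next
  fix y assume y: "y \<in> {0..<real (H k) * w k}"
  define n where "n = nat \<lfloor>y / w k\<rfloor>"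
  have "0 \<le> y / w k" "y / w k < H k"
    using y width_pos[of k] by (auto simp: field_simps)
  then have n: "real n \<le> y / w k" "y / w k < real n + 1" "n < H k"
    unfolding n_def by (linarith+)
  then have "real n * w k \<in> set (S k)" by (auto simp: set_stack)
  then obtain i where "i < H k" "S k ! i = real n * w k" by (metis in_set_conv_nth)
  moreover have "real n * w k \<le> y" "y < real n * w k + w k"
    using n width_pos[of k] by (auto simp: field_simps)
  ultimately show "y \<in> (\<Union>i<H k. L k i)" by (intro UN_I[of i]) (auto simp: mem_level)
qed

lemma level_subset_tower: "i < H k \<Longrightarrow> L k i \<subseteq> {0..<real (H k) * w k}"
  using tower_eq[of k] by blast

lemma tower_Suc: "real (H k) * w k \<le> real (H (Suc k)) * w (Suc k)"
proof -
  have "real (H k) * w k = real (p k * H k) * w (Suc k)"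
    by (simp add: width_Suc[of k])
  also have "\<dots> \<le> real (H (Suc k)) * w (Suc k)"
    by (intro mult_right_mono) (simp_all only: of_nat_le_iff length_stack_Suc width_nonneg le_add1)
  finally show ?thesis .
qed

lemma tower_mono: "incseq (\<lambda>k. real (H k) * w k)"
  by (rule incseq_SucI) (rule tower_Suc)

text \<open>The point lies in one of the columns, and the parts of the levels \<open>i\<close> and
  \<open>Suc i\<close> in this column are consecutive levels of the next stack.\<close>

lemma level_Suc_stack:
  assumes "Suc i < H k" "y \<in> L k i"
  obtains i' where "Suc i' < H (Suc k)" "y \<in> L (Suc k) i'"
    "S (Suc k) ! Suc i' - S (Suc k) ! i' = S k ! Suc i - S k ! i"
proof -
  define m where "m = nat \<lfloor>(y - S k ! i) / w (Suc k)\<rfloor>"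
  have "0 \<le> (y - S k ! i) / w (Suc k)" "(y - S k ! i) / w (Suc k) < p k"
    using assms(2) width_pos[of "Suc k"] width_Suc[of k] by (auto simp: mem_level field_simps)
  then have m: "real m \<le> (y - S k ! i) / w (Suc k)" "(y - S k ! i) / w (Suc k) < real m + 1" "m < p k"
    unfolding m_def by (linarith+)
  then have m': "S k ! i + real m * w (Suc k) \<le> y" "y < S k ! i + real m * w (Suc k) + w (Suc k)"
    using width_pos[of "Suc k"] by (auto simp: field_simps)
  obtain pre post where *: "S (Suc k) = pre @ map (\<lambda>b. b + real (Suc m - 1) * w (Suc k)) (S k) @ post"
    by (rule stack_Suc_column[of "Suc m" k]) (use m(3) in auto)
  have n: "S (Suc k) ! (length pre + i'') = S k ! i'' + real m * w (Suc k)" if "i'' < H k" for i''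
    using that unfolding * by (simp add: nth_append)
  show thesis
  proof (rule that[of "length pre + i"])
    show "Suc (length pre + i) < H (Suc k)" using assms(1) unfolding * by simp
    show "y \<in> L (Suc k) (length pre + i)"
      using m' n[of i] assms(1) by (auto simp: mem_level)
    show "S (Suc k) ! Suc (length pre + i) - S (Suc k) ! (length pre + i) = S k ! Suc i - S k ! i"
      using n[of i] n[of "Suc i"] assms(1) by simp
  qed
qed

lemma level_later_stack:
  assumes "k \<le> l" "Suc i < H k" "y \<in> L k i"
  shows "\<exists>i'. Suc i' < H l \<and> y \<in> L l i' \<and> S l ! Suc i' - S l ! i' = S k ! Suc i - S k ! i"
  using assms(1)
proof (induction rule: dec_induct)
  case base
  then show ?case using assms by blast
next
  case (step n)
  then obtain i' where "Suc i' < H n" "y \<in> L n i'" "S n ! Suc i' - S n ! i' = S k ! Suc i - S k ! i"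
    by blast
  with level_Suc_stack[of i' n y] show ?case by metis
qed

text \<open>Two successors of a point are compared in a common later stack, where the level that contains the
  point is unique.\<close>

lemma rank_one_step_unique:
  assumes "rank_one_step p a y z" "rank_one_step p a y z'"
  shows "z = z'"
proof -
  obtain k i where k: "Suc i < H k" "y \<in> L k i" "z = y - S k ! i + S k ! Suc i"
    using assms(1) unfolding rank_one_step_def by auto
  obtain l j where l: "Suc j < H l" "y \<in> L l j" "z' = y - S l ! j + S l ! Suc j"
    using assms(2) unfolding rank_one_step_def by auto
  let ?m = "max k l"
  obtain i' where i': "Suc i' < H ?m" "y \<in> L ?m i'" "S ?m ! Suc i' - S ?m ! i' = S k ! Suc i - S k ! i"
    using level_later_stack[OF _ k(1,2), of ?m] by auto
  obtain j' where j': "Suc j' < H ?m" "y \<in> L ?m j'" "S ?m ! Suc j' - S ?m ! j' = S l ! Suc j - S l ! j"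
    using level_later_stack[OF _ l(1,2), of ?m] by auto
  have "i' = j'"
    using level_disjoint[of i' ?m j' y] i' j' by simp
  then show ?thesis using k(3) l(3) i'(3) j'(3) by simp
qed

lemma T_on_level:
  assumes "Suc i < H k" "y \<in> L k i"
  shows "T y = y - S k ! i + S k ! Suc i"
proof -
  have "rank_one_step p a y (y - S k ! i + S k ! Suc i)"
    using assms unfolding rank_one_step_def by auto
  then show ?thesis
    unfolding rank_one_map_def using rank_one_step_unique by (auto intro!: the_equality)
qed

lemma T_off_levels:
  assumes "\<And>k i. Suc i < H k \<Longrightarrow> y \<notin> L k i"
  shows "T y = y"
  using assms unfolding rank_one_map_def rank_one_step_def by auto

end


section \<open>Approximation by functions constant on the cells of a grid\<close>

lemma measurable_floor_cell [measurable]: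
  fixes c :: "int \<Rightarrow> 'a :: topological_space"
  shows "(\<lambda>x::real. c \<lfloor>x / v\<rfloor>) \<in> borel_measurable borel"
proof -
  have "(\<lambda>x::real. \<lfloor>x / v\<rfloor>) \<in> borel \<rightarrow>\<^sub>M count_space UNIV" by measurable
  then show ?thesis
    by (rule measurable_compose) simp
qed

lemma floor_cell:
  fixes x v :: real
  assumes "0 < v"
  shows "of_int \<lfloor>x / v\<rfloor> * v \<le> x" "x < of_int \<lfloor>x / v\<rfloor> * v + v"
proof -
  have "of_int \<lfloor>x / v\<rfloor> * v \<le> (x / v) * v" "(x / v) * v < (of_int \<lfloor>x / v\<rfloor> + 1) * v"
    using assms by (intro mult_right_mono mult_strict_right_mono; linarith)+
  then show "of_int \<lfloor>x / v\<rfloor> * v \<le> x" "x < of_int \<lfloor>x / v\<rfloor> * v + v"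
    using assms by (auto simp: algebra_simps)
qed

text \<open>Take the cells that are contained in \<open>U\<close>. As the cells shrink, their union exhausts
  the open set \<open>U\<close> pointwise, and dominated convergence applies.\<close>

lemma open_set_approx_cells:
  fixes v :: "nat \<Rightarrow> real" and z :: complex
  assumes U: "open U" "emeasure lborel U < \<infinity>" and v: "\<And>k. 0 < v k" "v \<longlonglongrightarrow> 0" and e: "0 < e"
  shows "\<forall>\<^sub>F k in sequentially. \<exists>c :: int \<Rightarrow> complex. integrable lborel (\<lambda>x. c \<lfloor>x / v k\<rfloor>) \<and>
    (LINT x|lborel. cmod (indicator U x *\<^sub>R z - c \<lfloor>x / v k\<rfloor>)) < e"
proof -
  define c where "c k n = (if {of_int n * v k..<of_int n * v k + v k} \<subseteq> U then z else 0)" for k and n :: int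
  define G where "G = (\<lambda>x. indicator U x *\<^sub>R z)"
  have [measurable]: "U \<in> sets borel" using U by auto
  have [measurable]: "(\<lambda>x. c k \<lfloor>x / v k\<rfloor>) \<in> borel_measurable borel" for k by measurable
  have [measurable]: "G \<in> borel_measurable borel" unfolding G_def by measurable
  have G: "integrable lborel G"
    unfolding G_def using U by (intro integrable_scaleR_left) auto
  have le: "cmod (c k \<lfloor>x / v k\<rfloor>) \<le> cmod (G x)" for k x
    using floor_cell[OF v(1), of x k] unfolding c_def G_def by (auto simp: indicator_def)
  have ic: "integrable lborel (\<lambda>x. c k \<lfloor>x / v k\<rfloor>)" for k
    by (rule Bochner_Integration.integrable_bound[OF G]) (auto simp: le)
  have lim: "(\<lambda>k. c k \<lfloor>x / v k\<rfloor>) \<longlonglongrightarrow> G x" for x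
  proof (cases "x \<in> U")
    case False
    then have "c k \<lfloor>x / v k\<rfloor> = G x" for k
      using le[of k x] by (simp add: G_def)
    then show ?thesis by simp
  next
    case True
    then obtain r where r: "r > 0" "ball x r \<subseteq> U" using U(1) by (metis openE)
    have "\<forall>\<^sub>F k in sequentially. v k < r" using v(2) r(1) by (rule order_tendstoD)
    then have "\<forall>\<^sub>F k in sequentially. c k \<lfloor>x / v k\<rfloor> = G x"
    proof eventually_elim
      case (elim k)
      have "{of_int \<lfloor>x / v k\<rfloor> * v k..<of_int \<lfloor>x / v k\<rfloor> * v k + v k} \<subseteq> ball x r"
        using floor_cell[OF v(1), of x k] elim by (auto simp: dist_real_def)
      then show ?case using r True by (auto simp: c_def G_def)
    qed
    then show ?thesis by (rule tendsto_eventually)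
  qed
  have "(\<lambda>k. LINT x|lborel. cmod (G x - c k \<lfloor>x / v k\<rfloor>)) \<longlonglongrightarrow> (LINT x::real|lborel. 0 :: real)"
  proof (rule integral_dominated_convergence)
    show "integrable lborel (\<lambda>x. 2 * cmod (G x))" using G by simp
    show "AE x in lborel. (\<lambda>k. cmod (G x - c k \<lfloor>x / v k\<rfloor>)) \<longlonglongrightarrow> 0"
    proof (rule AE_I2)
      fix x
      show "(\<lambda>k. cmod (G x - c k \<lfloor>x / v k\<rfloor>)) \<longlonglongrightarrow> 0"
        using tendsto_norm[OF tendsto_diff[OF tendsto_const[of "G x"] lim[of x]]] by simp
    qed
    show "AE x in lborel. norm (cmod (G x - c k \<lfloor>x / v k\<rfloor>)) \<le> 2 * cmod (G x)" for k
    proof (rule AE_I2)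
      fix x
      show "norm (cmod (G x - c k \<lfloor>x / v k\<rfloor>)) \<le> 2 * cmod (G x)"
        using le[of k x] norm_triangle_ineq4[of "G x" "c k \<lfloor>x / v k\<rfloor>"] by simp
    qed
  qed (auto simp: borel_measurable_diff)
  then have "\<forall>\<^sub>F k in sequentially. (LINT x|lborel. cmod (G x - c k \<lfloor>x / v k\<rfloor>)) < e"
    using e by (intro order_tendstoD) auto
  then show ?thesis
    by eventually_elim (use ic in \<open>auto simp: G_def\<close>)
qed

lemma cells_approx_transfer:
  fixes f g :: "real \<Rightarrow> complex"
  assumes f: "integrable lborel f" and g: "integrable lborel g"
    and fg: "(LINT x|lborel. cmod (f x - g x)) < e1"
    and ex: "\<exists>c :: int \<Rightarrow> complex. integrable lborel (\<lambda>x. c \<lfloor>x / v\<rfloor>) \<and> (LINT x|lborel. cmod (g x - c \<lfloor>x / v\<rfloor>)) < e2"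
  shows "\<exists>c :: int \<Rightarrow> complex. integrable lborel (\<lambda>x. c \<lfloor>x / v\<rfloor>) \<and> (LINT x|lborel. cmod (f x - c \<lfloor>x / v\<rfloor>)) < e1 + e2"
proof -
  obtain c :: "int \<Rightarrow> complex" where c: "integrable lborel (\<lambda>x. c \<lfloor>x / v\<rfloor>)" "(LINT x|lborel. cmod (g x - c \<lfloor>x / v\<rfloor>)) < e2"
    using ex by blast
  have "(LINT x|lborel. cmod (f x - c \<lfloor>x / v\<rfloor>)) \<le>
     (LINT x|lborel. cmod (f x - g x) + cmod (g x - c \<lfloor>x / v\<rfloor>))"
    using f g c by (intro integral_mono) (auto intro: norm_diff_triangle_le)
  also have "\<dots> = (LINT x|lborel. cmod (f x - g x)) + (LINT x|lborel. cmod (g x - c \<lfloor>x / v\<rfloor>))"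
    using f g c by (intro Bochner_Integration.integral_add) auto
  finally show ?thesis using c fg by fastforce
qed

text \<open>Functions that are constant on the cells of a grid are dense in \<open>L\<^sup>1\<close> as the
  mesh tends to 0. Outer regularity reduces indicator functions of Borel sets to those of open sets.\<close>

lemma integrable_approx_cells:
  fixes g :: "real \<Rightarrow> complex" and v :: "nat \<Rightarrow> real"
  assumes g: "integrable lborel g" and v: "\<And>k. 0 < v k" "v \<longlonglongrightarrow> 0" and e: "0 < e"
  shows "\<forall>\<^sub>F k in sequentially. \<exists>c :: int \<Rightarrow> complex. integrable lborel (\<lambda>x. c \<lfloor>x / v k\<rfloor>) \<and>
    (LINT x|lborel. cmod (g x - c \<lfloor>x / v k\<rfloor>)) < e"
  using g e
proof (induction arbitrary: e rule: integrable_induct)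
  case (base A z)
  have A[measurable]: "A \<in> sets borel" using base by auto
  \<comment> \<open>The summand 1 keeps the denominator positive for \<open>z = 0\<close>.\<close>
  define d where "d = e / (2 * (cmod z + 1))"
  have d: "0 < d" "d * cmod z < e / 2"
    using base(3) unfolding d_def by (auto simp: field_simps add_pos_nonneg)
  obtain U where U: "open U" "A \<subseteq> U" "emeasure lborel (U - A) < d"
    using outer_regular_lborel[OF A d(1)] .
  have [measurable]: "U \<in> sets borel" using U by auto
  have "emeasure lborel U = emeasure lborel A + emeasure lborel (U - A)"
    using U(2) by (subst plus_emeasure) (auto simp: Un_absorb1)
  then have fin: "emeasure lborel U < \<infinity>"
    using U(3) base(2) by (auto simp: less_top[symmetric] dest: order.strict_trans2)
  have m: "measure lborel (U - A) < d"
    using U(3) d(1) by (simp add: measure_def) (metis enn2real_less_iff ennreal_less_top less_top order.strict_trans)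
  have iU: "integrable lborel (\<lambda>x. indicator U x *\<^sub>R z)" "integrable lborel (\<lambda>x. indicator A x *\<^sub>R z)"
    using fin base(2) by (auto intro!: integrable_scaleR_left)
  have "(LINT x|lborel. cmod (indicator A x *\<^sub>R z - indicator U x *\<^sub>R z)) =
        (LINT x|lborel. indicator (U - A) x *\<^sub>R cmod z)"
    using U(2) by (intro Bochner_Integration.integral_cong) (auto simp: indicator_def)
  also have "\<dots> = measure lborel (U - A) * cmod z" by simp
  also have "\<dots> \<le> d * cmod z" using m by (intro mult_right_mono) auto
  also have "\<dots> < e / 2" by (rule d)
  finally have AU: "(LINT x|lborel. cmod (indicator A x *\<^sub>R z - indicator U x *\<^sub>R z)) < e / 2" .
  have "0 < e / 2" using base(3) by simp
  from open_set_approx_cells[OF U(1) fin v this, of z] show ?case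
  proof eventually_elim
    case (elim k)
    from cells_approx_transfer[OF iU(2,1) AU elim] show ?case by simp
  qed
next
  case (add f g)
  have e2: "0 < e / 2" using add.prems by simp
  show ?case using add.IH(1)[OF e2] add.IH(2)[OF e2]
  proof eventually_elim
    case (elim k)
    from elim(1) obtain c where c: "integrable lborel (\<lambda>x. c \<lfloor>x / v k\<rfloor>)" "(LINT x|lborel. cmod (f x - c \<lfloor>x / v k\<rfloor>)) < e / 2"
      by blast
    from elim(2) obtain d where d: "integrable lborel (\<lambda>x. d \<lfloor>x / v k\<rfloor>)" "(LINT x|lborel. cmod (g x - d \<lfloor>x / v k\<rfloor>)) < e / 2"
      by blast
    have "(LINT x|lborel. cmod (f x + g x - (c \<lfloor>x / v k\<rfloor> + d \<lfloor>x / v k\<rfloor>))) \<le>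
     (LINT x|lborel. cmod (f x - c \<lfloor>x / v k\<rfloor>) + cmod (g x - d \<lfloor>x / v k\<rfloor>))"
      using add.hyps c d by (intro integral_mono) (auto simp: norm_diff_triangle_ineq)
    also have "\<dots> = (LINT x|lborel. cmod (f x - c \<lfloor>x / v k\<rfloor>)) + (LINT x|lborel. cmod (g x - d \<lfloor>x / v k\<rfloor>))"
      using add.hyps c d by (intro Bochner_Integration.integral_add) auto
    finally show ?case
      using c d by (intro exI[of _ "\<lambda>n. c n + d n"]) auto
  qed
next
  case (lim f s)
  have "(\<lambda>i. LINT x|lborel. cmod (f x - s i x)) \<longlonglongrightarrow> (LINT x::real|lborel. 0 :: real)"
  proof (rule integral_dominated_convergence)
    show "integrable lborel (\<lambda>x. 3 * cmod (f x))" using lim.hyps by simp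
    show "AE x in lborel. (\<lambda>i. cmod (f x - s i x)) \<longlonglongrightarrow> 0"
    proof (rule AE_I2)
      fix x
      show "(\<lambda>i. cmod (f x - s i x)) \<longlonglongrightarrow> 0"
        using tendsto_norm[OF tendsto_diff[OF tendsto_const[of "f x"] lim.hyps(2)[of x]]] by simp
    qed
    show "AE x in lborel. norm (cmod (f x - s i x)) \<le> 3 * cmod (f x)" for i
    proof (rule AE_I2)
      fix x
      show "norm (cmod (f x - s i x)) \<le> 3 * cmod (f x)"
        using lim.hyps(3)[of x i] norm_triangle_ineq4[of "f x" "s i x"] by simp
    qed
    show "(\<lambda>x. cmod (f x - s i x)) \<in> borel_measurable lborel" for i
      using lim.hyps by measurable
  qed auto
  then have "\<forall>\<^sub>F i in sequentially. (LINT x|lborel. cmod (f x - s i x)) < e / 2"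
    using lim.prems by (intro order_tendstoD) auto
  then obtain i where i: "(LINT x|lborel. cmod (f x - s i x)) < e / 2"
    using eventually_happens'[OF sequentially_bot] by blast
  have "0 < e / 2" using lim.prems by simp
  from lim.IH[OF this, of i] show ?case
  proof eventually_elim
    case (elim k)
    from cells_approx_transfer[OF lim.hyps(4) lim.hyps(1) i elim] show ?case by simp
  qed
qed


section \<open>Invariance of the measure\<close>

text \<open>\<open>real (H k) * w k\<close> is the total length of stack \<open>k\<close>, so the assumption says that the space has
  finite measure.\<close>

locale finite_cutting_and_stacking = cutting_and_stacking +
  assumes bdd_towers: "bdd_above (range (\<lambda>k. real (H k) * w k))"
begin

definition mass where "mass = (SUP k. real (H k) * w k)"

lemma tower_le: "real (H k) * w k \<le> mass"
  unfolding mass_def by (rule cSUP_upper[OF _ bdd_towers]) simp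

lemma tower_tendsto: "(\<lambda>k. real (H k) * w k) \<longlonglongrightarrow> mass"
  unfolding mass_def by (rule LIMSEQ_incseq_SUP[OF bdd_towers tower_mono])

lemma mass_ge_1: "1 \<le> mass"
  using tower_le[of 0] by (simp add: width_0)

lemma X_eq: "X = (\<Union>k. {0..<real (H k) * w k})"
  unfolding rank_one_set_def tower_eq ..

lemma tower_subset_X: "{0..<real (H k) * w k} \<subseteq> X"
  unfolding X_eq by blast

lemma level_subset_X: "i < H k \<Longrightarrow> L k i \<subseteq> X"
  using level_subset_tower tower_subset_X by blast

lemma X_subset: "X \<subseteq> {0..<mass}"
  unfolding X_eq using tower_le by (force intro: order.strict_trans2)

lemma X_borel [measurable]: "X \<in> sets borel"
  unfolding X_eq by measurable

lemma level_borel [measurable]: "L k i \<in> sets borel"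
  unfolding level_def by measurable

lemma measure_X: "emeasure lborel X = ennreal mass"
proof -
  have "(\<lambda>k. emeasure lborel {0..<real (H k) * w k}) \<longlonglongrightarrow> emeasure lborel (\<Union>k. {0..<real (H k) * w k})"
    using tower_mono by (intro Lim_emeasure_incseq) (auto simp: incseq_def intro: order_trans)
  then have "(\<lambda>k. ennreal (real (H k) * w k)) \<longlonglongrightarrow> emeasure lborel X"
    unfolding X_eq by (simp add: width_nonneg)
  moreover have "(\<lambda>k. ennreal (real (H k) * w k)) \<longlonglongrightarrow> ennreal mass"
    by (intro tendsto_ennrealI tower_tendsto)
  ultimately show ?thesis by (rule LIMSEQ_unique)
qed

lemma emeasure_level: "emeasure lborel (L k i) = ennreal (w k)"
  unfolding level_def by (simp add: width_nonneg)

lemma space_\<mu> [simp]: "space \<mu> = X"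
  by (simp add: rank_one_measure_def space_restrict_space)

lemma sets_\<mu>: "A \<in> sets \<mu> \<longleftrightarrow> A \<in> sets borel \<and> A \<subseteq> X"
  by (auto simp: rank_one_measure_def sets_restrict_space_iff)

lemma emeasure_\<mu>: "A \<in> sets borel \<Longrightarrow> A \<subseteq> X \<Longrightarrow> emeasure \<mu> A = emeasure lborel A / ennreal mass"
  unfolding rank_one_measure_def
  by (subst emeasure_uniform_measure)
    (auto simp: sets_restrict_space_iff emeasure_restrict_space measure_X Int_absorb1)

lemma AE_\<mu>: "(AE y in \<mu>. P y) \<longleftrightarrow> (AE y in lborel. y \<in> X \<longrightarrow> P y)"
proof -
  have "emeasure (restrict_space lborel X) X = ennreal mass"
    by (simp add: emeasure_restrict_space measure_X)
  then show ?thesis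
    unfolding rank_one_measure_def using mass_ge_1
    by (subst AE_uniform_measure) (auto simp: AE_restrict_space_iff)
qed

lemma prob_space_\<mu>: "prob_space \<mu>"
  using mass_ge_1 by (intro prob_spaceI) (auto simp: emeasure_\<mu> measure_X divide_ennreal)

text \<open>Transfer from the normalized measure to Lebesgue measure on the line, by extension with 0.\<close>

lemma integrable_\<mu>:
  fixes f :: "real \<Rightarrow> complex"
  assumes "integrable \<mu> f"
  shows "integrable lborel (\<lambda>x. indicator X x *\<^sub>R f x)"
proof -
  have f: "f \<in> borel_measurable (restrict_space lborel X)"
    using borel_measurable_integrable[OF assms] unfolding rank_one_measure_def uniform_measure_def by simp
  have e: "uniform_measure (restrict_space lborel X) X = density (restrict_space lborel X) (\<lambda>x. ennreal (1 / mass))"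
    unfolding uniform_measure_def
    by (intro density_cong) (use mass_ge_1 in \<open>auto simp: emeasure_restrict_space measure_X divide_ennreal[symmetric] sets_restrict_space_iff intro!: AE_I2 borel_measurable_divide_ennreal borel_measurable_indicator\<close>)
  have "integrable (restrict_space lborel X) (\<lambda>x. (1 / mass) *\<^sub>R f x)"
    using assms f mass_ge_1 unfolding rank_one_measure_def e by (subst (asm) integrable_density) auto
  then have "integrable (restrict_space lborel X) (\<lambda>x. mass *\<^sub>R ((1 / mass) *\<^sub>R f x))"
    by (rule integrable_scaleR_right)
  then have "integrable (restrict_space lborel X) f"
    using mass_ge_1 by simp
  then show ?thesis by (subst (asm) integrable_restrict_space) auto
qed

text \<open>The points on which the map is already defined by stack \<open>k\<close>.\<close>

definition moved :: "nat \<Rightarrow> real set" where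
  "moved k = (\<Union>i\<in>{i. Suc i < H k}. L k i)"

lemma moved_borel [measurable]: "moved k \<in> sets borel"
  unfolding moved_def by measurable

lemma moved_subset_X: "moved k \<subseteq> X"
  unfolding moved_def using level_subset_X by (auto dest: Suc_lessD)

lemma T_in_X: "y \<in> X \<Longrightarrow> T y \<in> X"
proof (cases "\<exists>k i. Suc i < H k \<and> y \<in> L k i")
  case True
  then obtain k i where "Suc i < H k" "y \<in> L k i" by blast
  then have "T y \<in> L k (Suc i)" using T_on_level[of i k y] by (auto simp: mem_level)
  then show ?thesis using level_subset_X[OF \<open>Suc i < H k\<close>] by blast
next
  case False
  assume "y \<in> X"
  moreover have "T y = y" using False by (intro T_off_levels) auto
  ultimately show ?thesis by simp
qed

lemma T_vimage_level:
  assumes "Suc i < H k"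
  shows "T -` A \<inter> L k i = (\<lambda>y. (S k ! Suc i - S k ! i) + 1 * y) -` (A \<inter> L k (Suc i))"
proof (rule set_eqI)
  fix y
  show "y \<in> T -` A \<inter> L k i \<longleftrightarrow> y \<in> (\<lambda>y. (S k ! Suc i - S k ! i) + 1 * y) -` (A \<inter> L k (Suc i))"
  proof (cases "y \<in> L k i")
    case True
    then have "T y = (S k ! Suc i - S k ! i) + 1 * y" using T_on_level[OF assms True] by simp
    then show ?thesis using True by (auto simp: mem_level)
  qed (auto simp: mem_level)
qed

lemma T_borel: "T \<in> borel_measurable borel"
proof (rule borel_measurableI)
  fix A :: "real set" assume "open A"
  then have [measurable]: "A \<in> sets borel" by auto
  let ?N = "UNIV - (\<Union>k. moved k)"
  have lev: "T -` A \<inter> L k i \<in> sets borel" if "Suc i < H k" for k i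
    unfolding T_vimage_level[OF that]
    by (rule measurable_sets_borel[where M = borel]) auto
  have pieces: "(\<Union>i\<in>{i. Suc i < H k}. T -` A \<inter> L k i) \<in> sets borel" for k
    by (rule sets.countable_UN') (auto intro: lev)
  have "T y = y" if "y \<in> ?N" for y
    using that by (intro T_off_levels) (auto simp: moved_def)
  then have "T -` A = (A \<inter> ?N) \<union> (\<Union>k. \<Union>i\<in>{i. Suc i < H k}. T -` A \<inter> L k i)"
    by (auto simp: moved_def)
  also have "\<dots> \<in> sets borel"
    by (rule sets.Un, force, rule sets.countable_nat_UN) (use pieces in blast)
  finally show "T -` A \<inter> space borel \<in> sets borel" by simp
qed

lemma emeasure_T_vimage_level:
  assumes "Suc i < H k" "A \<in> sets borel"
  shows "emeasure lborel (T -` A \<inter> L k i) = emeasure lborel (A \<inter> L k (Suc i))"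
proof -
  let ?g = "\<lambda>y. (S k ! Suc i - S k ! i) + 1 * y"
  have "emeasure lborel (A \<inter> L k (Suc i)) = emeasure (distr lborel borel ?g) (A \<inter> L k (Suc i))"
    using lborel_real_affine[of 1 "S k ! Suc i - S k ! i"] by (simp add: density_1)
  also have "\<dots> = emeasure lborel (?g -` (A \<inter> L k (Suc i)))"
    using assms by (subst emeasure_distr) auto
  finally show ?thesis unfolding T_vimage_level[OF assms(1)] by simp
qed

lemma level_disjoint_family: "I \<subseteq> {..<H k} \<Longrightarrow> disjoint_family_on (L k) I"
  unfolding disjoint_family_on_def using level_disjoint by blast

lemma moved_eq: "moved k = (\<Union>i<H k - 1. L k i)"
  unfolding moved_def by (intro arg_cong[where f = Union] image_cong) auto

text \<open>On the levels below the top one, the map is a piecewise translation onto the levels above the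
  bottom one.\<close>

lemma emeasure_T_vimage_moved:
  assumes A: "A \<in> sets borel"
  shows "emeasure lborel (T -` A \<inter> moved k) = emeasure lborel (A \<inter> (\<Union>i\<in>{1..<H k}. L k i))"
proof -
  have [measurable]: "T -` A \<in> sets borel"
    using measurable_sets[OF T_borel A] by simp
  have "emeasure lborel (T -` A \<inter> moved k) = emeasure lborel (\<Union>i<H k - 1. T -` A \<inter> L k i)"
    unfolding moved_eq by (simp only: Int_UN_distrib)
  also have "\<dots> = (\<Sum>i<H k - 1. emeasure lborel (T -` A \<inter> L k i))"
    using level_disjoint_family[of "{..<H k - 1}" k]
    by (intro sum_emeasure[symmetric]) (auto simp: disjoint_family_on_def)
  also have "\<dots> = (\<Sum>i<H k - 1. emeasure lborel (A \<inter> L k (Suc i)))"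
    using A by (intro sum.cong refl emeasure_T_vimage_level) auto
  also have "\<dots> = (\<Sum>i\<in>{1..<H k}. emeasure lborel (A \<inter> L k i))"
    by (rule sum.reindex_bij_witness[of _ "\<lambda>i. i - 1" Suc]) auto
  also have "\<dots> = emeasure lborel (\<Union>i\<in>{1..<H k}. A \<inter> L k i)"
  proof (rule sum_emeasure)
    have "disjoint_family_on (L k) {1..<H k}" by (rule level_disjoint_family) auto
    then show "disjoint_family_on (\<lambda>i. A \<inter> L k i) {1..<H k}"
      unfolding disjoint_family_on_def by blast
  qed (use A in auto)
  also have "(\<Union>i\<in>{1..<H k}. A \<inter> L k i) = A \<inter> (\<Union>i\<in>{1..<H k}. L k i)" by blast
  finally show ?thesis .
qed

text \<open>A stack without one level misses little of the space: the points outside the stack and the one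
  level of measure \<open>w k\<close>. It is applied to the top level, where the map is not yet defined, and
  to the bottom level, which is not yet in its range.\<close>

lemma all_but_one_level:
  assumes A: "A \<in> sets borel" and i: "i < H k" and Y: "Y \<in> sets borel" "{0..<real (H k) * w k} - L k i \<subseteq> Y" "Y \<subseteq> X"
  shows "measure lborel (A \<inter> X) - (mass - real (H k) * w k + w k) \<le> measure lborel (A \<inter> Y)"
    "measure lborel (A \<inter> Y) \<le> measure lborel (A \<inter> X)"
proof -
  let ?R = "{real (H k) * w k..<mass} \<union> L k i"
  have fin: "emeasure lborel B < \<infinity>" if "B \<subseteq> X" for B
    using emeasure_mono[OF that, of lborel] by (auto simp: measure_X less_top[symmetric] top_unique)
  have "measure lborel (A \<inter> X) \<le> measure lborel ((A \<inter> Y) \<union> ?R)"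
  proof (rule measure_mono_fmeasurable)
    show "A \<inter> X \<subseteq> A \<inter> Y \<union> ?R" using Y(2) X_subset by fastforce
    show "A \<inter> X \<in> sets lborel" using A by simp
    have "A \<inter> Y \<in> fmeasurable lborel" using A Y fin[of "A \<inter> Y"] by (intro fmeasurableI) auto
    moreover have "L k i \<in> fmeasurable lborel" by (intro fmeasurableI) (auto simp: emeasure_level)
    moreover have "{real (H k) * w k..<mass} \<in> fmeasurable lborel" 
      using tower_le[of k] by (intro fmeasurableI) auto
    ultimately show "(A \<inter> Y) \<union> ?R \<in> fmeasurable lborel" by (intro fmeasurable.Un)
  qed
  also have "\<dots> \<le> measure lborel (A \<inter> Y) + measure lborel ?R"
    using A Y by (intro measure_Un_le) auto
  also have "measure lborel ?R \<le> measure lborel {real (H k) * w k..<mass} + measure lborel (L k i)"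
    by (intro measure_Un_le) auto
  also have "\<dots> = mass - real (H k) * w k + w k"
    using tower_le[of k] emeasure_level[of k i] width_nonneg[of k] by (simp add: measure_def)
  finally show "measure lborel (A \<inter> X) - (mass - real (H k) * w k + w k) \<le> measure lborel (A \<inter> Y)" by simp
  show "measure lborel (A \<inter> Y) \<le> measure lborel (A \<inter> X)"
    using A Y fin[of "A \<inter> X"] by (intro measure_mono_fmeasurable) (auto intro!: fmeasurableI)
qed

lemma all_but_one_level_tendsto:
  assumes A: "A \<in> sets borel" and i: "\<And>k. i k < H k"
    and Y: "\<And>k. Y k \<in> sets borel" "\<And>k. {0..<real (H k) * w k} - L k (i k) \<subseteq> Y k" "\<And>k. Y k \<subseteq> X"
  shows "(\<lambda>k. measure lborel (A \<inter> Y k)) \<longlonglongrightarrow> measure lborel (A \<inter> X)"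
proof (rule tendsto_sandwich)
  show "\<forall>\<^sub>F k in sequentially. measure lborel (A \<inter> X) - (mass - real (H k) * w k + w k) \<le> measure lborel (A \<inter> Y k)"
    "\<forall>\<^sub>F k in sequentially. measure lborel (A \<inter> Y k) \<le> measure lborel (A \<inter> X)"
    using all_but_one_level[OF A i Y] by auto
  have "(\<lambda>k. measure lborel (A \<inter> X) - (mass - real (H k) * w k + w k)) \<longlonglongrightarrow> measure lborel (A \<inter> X) - (mass - mass + 0)"
    by (intro tendsto_intros tower_tendsto width_tendsto_0)
  then show "(\<lambda>k. measure lborel (A \<inter> X) - (mass - real (H k) * w k + w k)) \<longlonglongrightarrow> measure lborel (A \<inter> X)"
    by simp
qed simp

text \<open>Both sides of \<open>emeasure_T_vimage_moved\<close> converge to the measures on the whole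
  space.\<close>

lemma emeasure_T_vimage:
  assumes A: "A \<in> sets borel"
  shows "emeasure lborel (T -` A \<inter> X) = emeasure lborel (A \<inter> X)"
proof -
  have TA: "T -` A \<in> sets borel" using measurable_sets[OF T_borel A] by simp
  have 1: "(\<lambda>k. measure lborel (T -` A \<inter> moved k)) \<longlonglongrightarrow> measure lborel (T -` A \<inter> X)"
  proof (rule all_but_one_level_tendsto[OF TA])
    show "H k - 1 < H k" for k using height_pos[of k] by simp
    show "{0..<real (H k) * w k} - L k (H k - 1) \<subseteq> moved k" for k
    proof
      fix y assume y: "y \<in> {0..<real (H k) * w k} - L k (H k - 1)"
      then obtain i where "i < H k" "y \<in> L k i" unfolding tower_eq[symmetric] by blast
      moreover from this y have "i \<noteq> H k - 1" by blast
      ultimately show "y \<in> moved k" unfolding moved_eq by auto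
    qed
  qed (auto simp: moved_subset_X)
  have "(\<lambda>k. measure lborel (A \<inter> (\<Union>i\<in>{1..<H k}. L k i))) \<longlonglongrightarrow> measure lborel (A \<inter> X)"
  proof (rule all_but_one_level_tendsto[OF A])
    show "0 < H k" for k by (rule height_pos)
    show "{0..<real (H k) * w k} - L k 0 \<subseteq> (\<Union>i\<in>{1..<H k}. L k i)" for k
    proof
      fix y assume y: "y \<in> {0..<real (H k) * w k} - L k 0"
      then obtain i where "i < H k" "y \<in> L k i" unfolding tower_eq[symmetric] by blast
      moreover from this y have "i \<noteq> 0" by (metis DiffD2)
      ultimately show "y \<in> (\<Union>i\<in>{1..<H k}. L k i)" by (intro UN_I[of i]) auto
    qed
    show "(\<Union>i\<in>{1..<H k}. L k i) \<subseteq> X" for k by (intro UN_least level_subset_X) simp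
  qed auto
  moreover have "measure lborel (T -` A \<inter> moved k) = measure lborel (A \<inter> (\<Union>i\<in>{1..<H k}. L k i))" for k
    using emeasure_T_vimage_moved[OF A] by (simp add: measure_def)
  ultimately have "measure lborel (T -` A \<inter> X) = measure lborel (A \<inter> X)"
    using 1 LIMSEQ_unique by simp
  moreover have "emeasure lborel (B \<inter> X) \<noteq> \<infinity>" for B
    using emeasure_mono[of "B \<inter> X" X lborel] by (auto simp: measure_X top_unique)
  ultimately show ?thesis by (simp add: emeasure_eq_ennreal_measure)
qed

lemma measure_preserving_T: "measure_preserving_map \<mu> T"
  unfolding measure_preserving_map_def
proof (intro conjI measure_eqI)
  have vim: "T -` A \<inter> X \<in> sets borel" if "A \<in> sets borel" for A
    using measurable_sets[OF T_borel that] by auto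
  show m: "T \<in> measurable \<mu> \<mu>"
    by (rule measurableI) (auto simp: T_in_X sets_\<mu> vim)
  show "sets (distr \<mu> \<mu> T) = sets \<mu>" by simp
  fix A assume "A \<in> sets (distr \<mu> \<mu> T)"
  then have A: "A \<in> sets \<mu>" "A \<in> sets borel" "A \<subseteq> X" by (auto simp: sets_\<mu>)
  have "emeasure (distr \<mu> \<mu> T) A = emeasure \<mu> (T -` A \<inter> X)"
    using A m by (subst emeasure_distr) auto
  also have "\<dots> = emeasure lborel (T -` A \<inter> X) / ennreal mass"
    using A vim by (intro emeasure_\<mu>) auto
  also have "\<dots> = emeasure lborel (A \<inter> X) / ennreal mass"
    using emeasure_T_vimage[OF A(2)] by simp
  also have "\<dots> = emeasure \<mu> A"
    using A by (simp add: emeasure_\<mu> Int_absorb2)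
  finally show "emeasure (distr \<mu> \<mu> T) A = emeasure \<mu> A" .
qed

end


section \<open>Eigenfunctions of rank one transformations\<close>

context finite_cutting_and_stacking
begin

lemma integral_level:
  fixes g :: "real \<Rightarrow> real"
  shows "(LINT y|lborel. indicator (L k i) y * g y) = (LINT s|lborel. indicator {0..<w k} s * g (s + S k ! i))"
proof -
  have "(LINT y|lborel. indicator (L k i) y * g y) =
    (LINT s|lborel. indicator (L k i) (S k ! i + 1 * s) * g (S k ! i + 1 * s))"
    by (subst lborel_integral_real_affine[of 1 _ "S k ! i"]) simp_all
  also have "\<dots> = (LINT s|lborel. indicator {0..<w k} s * g (s + S k ! i))"
    by (intro Bochner_Integration.integral_cong) (auto simp: indicator_def mem_level add.commute)
  finally show ?thesis .
qed

lemma indicator_tower: "indicator {0..<real (H k) * w k} y = (\<Sum>i<H k. indicator (L k i) y :: real)"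
  unfolding tower_eq[symmetric] by (rule indicator_UN_disjoint) (auto intro: level_disjoint_family)

lemma integral_tower:
  fixes g :: "real \<Rightarrow> real"
  assumes "integrable lborel g"
  shows "(LINT y|lborel. indicator {0..<real (H k) * w k} y * g y) = (\<Sum>i<H k. LINT y|lborel. indicator (L k i) y * g y)"
proof -
  have "integrable lborel (\<lambda>y. indicator (L k i) y * g y)" for i
    using integrable_mult_indicator[OF _ assms, of "L k i"] by simp
  then show ?thesis
    unfolding indicator_tower sum_distrib_right by (intro Bochner_Integration.integral_sum)
qed

end

text \<open>The eigenfunction is extended by 0 to the whole line, where integrals are invariant under
  translation.\<close>

locale koopman_eigenfunction_on_line = finite_cutting_and_stacking +
  fixes f :: "real \<Rightarrow> complex" and l :: complex
  assumes f_integrable: "integrable lborel f"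
    and f_off_X: "\<And>y. y \<notin> X \<Longrightarrow> f y = 0"
    and l_unimodular: "cmod l = 1"
    and f_eigen: "AE y in lborel. y \<in> X \<longrightarrow> f (T y) = l * f y"
begin

lemma f_borel [measurable]: "f \<in> borel_measurable borel"
  using borel_measurable_integrable[OF f_integrable] by simp

lemma integrable_base [simp, intro]: "integrable lborel (\<lambda>s. indicator {u..<v} s * cmod (f s - z))" for u v :: real
proof -
  have "integrable lborel (\<lambda>s. indicator {u..<v} s *\<^sub>R z)"
    by (intro integrable_scaleR_left integrable_real_indicator) (cases "u \<le> v"; simp)+
  moreover have "integrable lborel (\<lambda>s. indicator {u..<v} s *\<^sub>R f s)"
    by (intro integrable_mult_indicator f_integrable) auto
  ultimately have "integrable lborel (\<lambda>s. indicator {u..<v} s *\<^sub>R f s - indicator {u..<v} s *\<^sub>R z)"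
    by (intro Bochner_Integration.integrable_diff)
  from integrable_norm[OF this] show ?thesis
    by (rule Bochner_Integration.integrable_cong[THEN iffD1, rotated -1]) (auto simp: indicator_def)
qed

text \<open>Iterating the eigenvalue equation up the stack, started at the bottom level, which is the interval
  from 0 to \<open>w k\<close>.\<close>

lemma eigen_on_levels: "AE s in lborel. s \<in> {0..<w k} \<longrightarrow> (\<forall>i<H k. f (s + S k ! i) = l ^ i * f s)"
proof -
  have "AE s in lborel. s \<in> {0..<w k} \<longrightarrow> f (s + S k ! Suc i) = l * f (s + S k ! i)" if i: "Suc i < H k" for i
  proof -
    have "(\<lambda>y. f (T y)) \<in> borel_measurable borel"
      by (rule measurable_compose[OF T_borel f_borel])
    then have "(\<lambda>y. f (T y) - l * f y) \<in> borel_measurable borel"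
      by (intro borel_measurable_diff borel_measurable_times f_borel borel_measurable_const)
    from measurable_sets_borel[OF this, of "{0}"]
    have "(\<lambda>y. f (T y) - l * f y) -` {0} \<in> sets borel" by simp
    also have "(\<lambda>y. f (T y) - l * f y) -` {0} = {y. f (T y) = l * f y}"
      by (simp only: vimage_def singleton_iff right_minus_eq)
    finally have "(- X) \<union> {y. f (T y) = l * f y} \<in> sets borel"
      by (rule sets.Un[OF borel_comp[OF X_borel]])
    moreover have "{y. y \<in> X \<longrightarrow> f (T y) = l * f y} = (- X) \<union> {y. f (T y) = l * f y}" by blast
    ultimately have "Measurable.pred borel (\<lambda>y. y \<in> X \<longrightarrow> f (T y) = l * f y)"
      unfolding pred_def by (simp only: space_borel UNIV_I simp_thms)
    from AE_borel_affine[OF _ this f_eigen, of 1 "S k ! i"]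
    have "AE s in lborel. S k ! i + s \<in> X \<longrightarrow> f (T (S k ! i + s)) = l * f (S k ! i + s)"
      by (simp only: mult_1 one_neq_zero not_False_eq_True simp_thms)
    then show ?thesis
    proof eventually_elim
      case (elim s)
      show ?case
      proof
        assume "s \<in> {0..<w k}"
        then have y: "S k ! i + s \<in> L k i" by (simp add: mem_level)
        then have "S k ! i + s \<in> X" using level_subset_X[of i k] i by auto
        then show "f (s + S k ! Suc i) = l * f (s + S k ! i)"
          using elim T_on_level[OF i y] by (simp add: add.commute)
      qed
    qed
  qed
  then have "AE s in lborel. \<forall>i\<in>{i. Suc i < H k}. s \<in> {0..<w k} \<longrightarrow> f (s + S k ! Suc i) = l * f (s + S k ! i)"
    by (intro AE_ball_countable[THEN iffD2] ballI) auto
  then show ?thesis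
  proof eventually_elim
    case (elim s)
    show ?case
    proof (intro impI allI)
      fix i assume s: "s \<in> {0..<w k}" and "i < H k"
      from this(2) show "f (s + S k ! i) = l ^ i * f s"
        by (induction i) (use elim s in \<open>auto simp: stack_bottom mult.assoc\<close>)
    qed
  qed
qed

lemma l_power [simp]: "cmod (l ^ i) = 1"
  by (simp add: norm_power l_unimodular)

lemma l_nonzero [simp]: "l \<noteq> 0"
  using l_unimodular by auto

text \<open>Since \<open>l\<close> has modulus 1, the distance of \<open>f\<close> to constants is the same on
  all levels once the constants are rotated accordingly.\<close>

lemma integral_level_dist:
  assumes "i < H k"
  shows "(LINT y|lborel. indicator (L k i) y * cmod (f y - l ^ i * z)) = (LINT s|lborel. indicator {0..<w k} s * cmod (f s - z))"
  unfolding integral_level[of k i "\<lambda>y. cmod (f y - l ^ i * z)"]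
proof (rule integral_cong_AE)
  show "AE s in lborel. indicator {0..<w k} s * cmod (f (s + S k ! i) - l ^ i * z) = indicator {0..<w k} s * cmod (f s - z)"
    using eigen_on_levels[of k]
  proof eventually_elim
    case (elim s)
    have "cmod (l ^ i * f s - l ^ i * z) = cmod (f s - z)"
      by (simp only: right_diff_distrib[symmetric] norm_mult l_power mult_1)
    then show ?case using elim assms by (auto simp: indicator_def)
  qed
qed measurable

lemma integral_level_norm:
  assumes "i < H k"
  shows "(LINT y|lborel. indicator (L k i) y * cmod (f y)) = (LINT s|lborel. indicator {0..<w k} s * cmod (f s))"
  using integral_level_dist[OF assms, of 0] by simp

lemma integral_tower_norm:
  "real (H k) * (LINT s|lborel. indicator {0..<w k} s * cmod (f s)) = (LINT y|lborel. indicator {0..<real (H k) * w k} y * cmod (f y))"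
  using f_integrable by (simp add: integral_tower integral_level_norm)

text \<open>Approximate \<open>f\<close> by a function that is constant on levels. By
  \<open>integral_level_dist\<close> the error on each level equals the error of approximating
  \<open>f\<close> on the bottom level by some constant, and for one of the levels it is at most the
  average.\<close>

lemma base_almost_constant:
  assumes e: "0 < e"
  shows "\<forall>\<^sub>F k in sequentially. \<exists>z. real (H k) * (LINT s|lborel. indicator {0..<w k} s * cmod (f s - z)) < e"
  using integrable_approx_cells[OF f_integrable width_pos width_tendsto_0 e]
proof eventually_elim
  case (elim k)
  then obtain d :: "int \<Rightarrow> complex" where d: "integrable lborel (\<lambda>x. d \<lfloor>x / w k\<rfloor>)" "(LINT x|lborel. cmod (f x - d \<lfloor>x / w k\<rfloor>)) < e"
    by blast
  have int: "integrable lborel (\<lambda>x. cmod (f x - d \<lfloor>x / w k\<rfloor>))" using d(1) f_integrable by auto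
  \<comment> \<open>The constant value on level \<open>i\<close>, rotated back to the bottom level.\<close>
  define z where "z i = d \<lfloor>S k ! i / w k\<rfloor> / l ^ i" for i
  define D where "D i = (LINT s|lborel. indicator {0..<w k} s * cmod (f s - z i))" for i
  have "(LINT y|lborel. indicator (L k i) y * cmod (f y - d \<lfloor>y / w k\<rfloor>)) = D i" if i: "i < H k" for i
  proof -
    have "S k ! i \<in> L k i" by (simp add: mem_level width_pos)
    then have "\<lfloor>y / w k\<rfloor> = \<lfloor>S k ! i / w k\<rfloor>" if "y \<in> L k i" for y
      using floor_on_level[OF i that] floor_on_level[OF i] width_pos[of k] by force
    then have "(LINT y|lborel. indicator (L k i) y * cmod (f y - d \<lfloor>y / w k\<rfloor>)) = (LINT y|lborel. indicator (L k i) y * cmod (f y - l ^ i * z i))"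
      by (intro Bochner_Integration.integral_cong) (auto simp: indicator_def z_def)
    then show ?thesis unfolding D_def using integral_level_dist[OF i] by simp
  qed
  then have "(\<Sum>i<H k. D i) = (LINT y|lborel. indicator {0..<real (H k) * w k} y * cmod (f y - d \<lfloor>y / w k\<rfloor>))"
    by (simp add: integral_tower[OF int])
  also have "\<dots> \<le> (LINT y|lborel. cmod (f y - d \<lfloor>y / w k\<rfloor>))"
    by (rule integral_mono'[OF int]) (auto simp: indicator_def)
  also have "\<dots> < e" by (rule d)
  finally have less: "(\<Sum>i<H k. D i) < e" .
  have "\<exists>i. real (H k) * D i < e"
  proof (rule ccontr)
    assume "\<not> ?thesis"
    then have "e / real (H k) \<le> D i" for i
      using height_pos[of k] by (simp add: not_less divide_le_eq mult.commute)
    then have "(\<Sum>i<H k. e / real (H k)) \<le> (\<Sum>i<H k. D i)" by (intro sum_mono)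
    then show False using less height_pos[of k] by simp
  qed
  then show ?case unfolding D_def by blast
qed

lemma tower_norm_tendsto:
  "(\<lambda>k. LINT y|lborel. indicator {0..<real (H k) * w k} y * cmod (f y)) \<longlonglongrightarrow> (LINT y|lborel. cmod (f y))"
proof (rule integral_dominated_convergence)
  show "integrable lborel (\<lambda>y. cmod (f y))" using f_integrable by simp
  show "AE y in lborel. (\<lambda>k. indicator {0..<real (H k) * w k} y * cmod (f y)) \<longlonglongrightarrow> cmod (f y)"
  proof (rule AE_I2)
    fix y
    show "(\<lambda>k. indicator {0..<real (H k) * w k} y * cmod (f y)) \<longlonglongrightarrow> cmod (f y)"
    proof (cases "y \<in> X")
      case True
      then obtain m where m: "0 \<le> y" "y < real (H m) * w m" unfolding X_eq by auto
      have "\<forall>\<^sub>F k in sequentially. indicator {0..<real (H k) * w k} y * cmod (f y) = cmod (f y)"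
        using eventually_ge_at_top[of m]
      proof eventually_elim
        case (elim k)
        then show ?case using m incseqD[OF tower_mono elim] by (auto simp: indicator_def)
      qed
      then show ?thesis by (rule tendsto_eventually)
    qed (simp add: f_off_X)
  qed
qed (auto simp: indicator_def)

text \<open>Let \<open>m = H k + a k 1\<close> and \<open>v = w (Suc k)\<close>. On the first column of the
  bottom level \<open>f (s + v) = l ^ m * f s\<close>, while \<open>f (s + v)\<close> and \<open>f s\<close>
  are close to the same constant. So \<open>cmod (l ^ m - 1)\<close> times the integral of
  \<open>cmod f\<close> over this column is small compared to \<open>1 / H k\<close>, whereas the integral
  itself is about \<open>A / H (Suc k)\<close>, where \<open>A\<close> is the \<open>L\<^sup>1\<close> norm of
  \<open>f\<close>.\<close>

lemma eigenvalue_power_tendsto_1: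
  assumes ratio: "\<And>k. real (H (Suc k)) \<le> R * real (H k)"
    and nonzero: "\<not> (AE y in lborel. f y = 0)"
  shows "(\<lambda>k. l ^ (H k + a k 1)) \<longlonglongrightarrow> 1"
proof (rule LIMSEQ_I)
  fix r :: real assume r: "0 < r"
  define A where "A = (LINT y|lborel. cmod (f y))"
  have "A \<noteq> 0"
    unfolding A_def using nonzero f_integrable by (subst integral_nonneg_eq_0_iff_AE) auto
  then have A: "0 < A"
    unfolding A_def by (simp add: less_le)
  have "1 * real (H 0) \<le> real (H (Suc 0))"
    using p_pos[of 0] unfolding of_nat_le_iff mult_1 length_stack_Suc
    by (simp add: trans_le_add1)
  then have R: "0 < R" using ratio[of 0] height_pos[of 0] by (simp add: zero_less_mult_iff) 
  \<comment> \<open>Chosen such that \<open>2 * R * e = r * (A / 2)\<close> in the last step.\<close>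
  define e where "e = r * A / (4 * R)"
  have e: "0 < e" unfolding e_def using r A R by simp
  have "\<forall>\<^sub>F k in sequentially. A / 2 < (LINT y|lborel. indicator {0..<real (H k) * w k} y * cmod (f y))"
    using A by (intro order_tendstoD[OF tower_norm_tendsto[folded A_def]]) simp
  then have "\<forall>\<^sub>F k in sequentially. A / 2 < real (H (Suc k)) * (LINT s|lborel. indicator {0..<w (Suc k)} s * cmod (f s))"
    unfolding integral_tower_norm
    by (subst eventually_sequentially_Suc[of "\<lambda>k. A / 2 < (LINT y|lborel. indicator {0..<real (H k) * w k} y * cmod (f y))"])
  moreover note base_almost_constant[OF e]
  ultimately have "\<forall>\<^sub>F k in sequentially. norm (l ^ (H k + a k 1) - 1) < r"
  proof eventually_elim
    case (elim k)
    then obtain z where z: "real (H k) * (LINT s|lborel. indicator {0..<w k} s * cmod (f s - z)) < e" by blast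
    let ?v = "w (Suc k)" and ?m = "H k + a k 1"
    define B where "B = (LINT s|lborel. indicator {0..<?v} s * cmod (f s))"
    define D where "D = (LINT s|lborel. indicator {0..<w k} s * cmod (f s - z))"
    have "2 * ?v \<le> real (p k) * ?v" using two_le_p[of k] width_nonneg by (intro mult_right_mono) auto
    then have v: "2 * ?v \<le> w k" by (simp add: width_Suc[of k])
    have sh: "(LINT s|lborel. indicator {0..<?v} s * cmod (f (s + ?v) - z)) = (LINT s|lborel. indicator {?v..<2 * ?v} s * cmod (f s - z))"
      by (subst lborel_integral_real_affine[of 1 "\<lambda>s. indicator {?v..<2 * ?v} s * cmod (f s - z)" ?v])
        (auto intro!: Bochner_Integration.integral_cong simp: indicator_def add.commute)
    have ish: "integrable lborel (\<lambda>s. indicator {0..<?v} s * cmod (f (s + ?v) - z))"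
      using lborel_integrable_real_affine[OF integrable_base[of ?v "2 * ?v" z], of 1 ?v]
      by (rule Bochner_Integration.integrable_cong[THEN iffD1, rotated -1]) (auto simp: indicator_def add.commute)
    have "cmod (l ^ ?m - 1) * B = (LINT s|lborel. indicator {0..<?v} s * (cmod (l ^ ?m - 1) * cmod (f s)))"
      unfolding B_def by (simp flip: integral_mult_right_zero add: mult.left_commute)
    also have "\<dots> = (LINT s|lborel. indicator {0..<?v} s * cmod (f (s + ?v) - f s))"
    proof (rule integral_cong_AE)
      show "AE s in lborel. indicator {0..<?v} s * (cmod (l ^ ?m - 1) * cmod (f s)) = indicator {0..<?v} s * cmod (f (s + ?v) - f s)"
        using eigen_on_levels[of "Suc k"]
      proof eventually_elim
        case (elim s)
        have "f (s + ?v) - f s = (l ^ ?m - 1) * f s" if "s \<in> {0..<?v}"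
        proof -
          have "f (s + S (Suc k) ! ?m) = l ^ ?m * f s"
            using elim that stack_second_column(1)[of k] by blast
          then show ?thesis
            unfolding stack_second_column(2) by (simp add: left_diff_distrib)
        qed
        then show ?case by (auto simp: indicator_def norm_mult)
      qed
    qed measurable
    also have "\<dots> \<le> (LINT s|lborel. indicator {0..<?v} s * cmod (f (s + ?v) - z) + indicator {0..<?v} s * cmod (f s - z))"
    proof (rule integral_mono')
      show "indicator {0..<?v} s * cmod (f (s + ?v) - f s) \<le> indicator {0..<?v} s * cmod (f (s + ?v) - z) + indicator {0..<?v} s * cmod (f s - z)" for s
        using norm_triangle_ineq4[of "f (s + ?v) - z" "f s - z"] by (auto simp: indicator_def)
    qed (use ish in auto)
    also have "\<dots> = (LINT s|lborel. indicator {?v..<2 * ?v} s * cmod (f s - z)) + (LINT s|lborel. indicator {0..<?v} s * cmod (f s - z))"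
      using ish by (subst Bochner_Integration.integral_add) (auto simp: sh)
    also have "\<dots> \<le> D + D"
      unfolding D_def using v width_nonneg[of "Suc k"]
      by (intro add_mono integral_mono integrable_base) (auto simp: indicator_def)
    finally have BD: "cmod (l ^ ?m - 1) * B \<le> 2 * D" by simp
    have "cmod (l ^ ?m - 1) * (A / 2) \<le> cmod (l ^ ?m - 1) * (real (H (Suc k)) * B)"
      using elim(1) unfolding B_def by (intro mult_left_mono) auto
    also have "\<dots> = real (H (Suc k)) * (cmod (l ^ ?m - 1) * B)" by simp
    also have "\<dots> \<le> (R * real (H k)) * (2 * D)"
    proof (rule mult_mono[OF ratio BD])
      show "0 \<le> R * real (H k)" using R by simp
      show "0 \<le> cmod (l ^ ?m - 1) * B" unfolding B_def by (intro mult_nonneg_nonneg Bochner_Integration.integral_nonneg) auto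
    qed
    also have "\<dots> = 2 * R * (real (H k) * D)" by simp
    also have "\<dots> < 2 * R * e" using z R unfolding D_def by (intro mult_strict_left_mono) auto
    also have "\<dots> = r * (A / 2)" unfolding e_def using R by simp
    finally show ?case using A by simp
  qed
  then show "\<exists>n. \<forall>k\<ge>n. norm (l ^ (H k + a k 1) - 1) < r"
    by (simp add: eventually_sequentially)
qed

text \<open>For \<open>l = 1\<close> the near constancy on the bottom level holds with the same constant on
  the whole stack. The constants of different stages form a Cauchy sequence because all stacks contain the
  initial unit interval.\<close>

lemma invariant_constant:
  assumes l: "l = 1"
  shows "\<exists>z. AE y in lborel. y \<in> X \<longrightarrow> f y = z"
proof -
  define I where "I k z = (LINT y|lborel. indicator {0..<real (H k) * w k} y * cmod (f y - z))" for k z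
  have I: "I k z = real (H k) * (LINT s|lborel. indicator {0..<w k} s * cmod (f s - z))" for k z
  proof -
    have "I k z = (\<Sum>i<H k. LINT y|lborel. indicator (L k i) y * cmod (f y - z))"
    proof -
      have "integrable lborel (\<lambda>y. indicator (L k i) y * cmod (f y - z))" for i
        unfolding level_def by simp
      then show ?thesis
        unfolding I_def indicator_tower sum_distrib_right by (intro Bochner_Integration.integral_sum)
    qed
    also have "\<dots> = (\<Sum>i<H k. LINT s|lborel. indicator {0..<w k} s * cmod (f s - z))"
      using integral_level_dist[of _ k z] by (intro sum.cong) (auto simp: l)
    finally show ?thesis by simp
  qed
  have I_mono: "I j z \<le> I k z" if "j \<le> k" for j k z
    unfolding I_def using incseqD[OF tower_mono that]
    by (intro integral_mono integrable_base) (auto simp: indicator_def)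
  have I_tri: "real (H k) * w k * cmod (z - z') \<le> I k z + I k z'" for k z z'
  proof -
    have "real (H k) * w k * cmod (z - z') = (LINT y|lborel. indicator {0..<real (H k) * w k} y * cmod (z - z'))"
      by (simp add: width_nonneg)
    also have "\<dots> \<le> (LINT y|lborel. indicator {0..<real (H k) * w k} y * cmod (f y - z) + indicator {0..<real (H k) * w k} y * cmod (f y - z'))"
    proof (rule integral_mono')
      show "indicator {0..<real (H k) * w k} y * cmod (z - z') \<le> indicator {0..<real (H k) * w k} y * cmod (f y - z) + indicator {0..<real (H k) * w k} y * cmod (f y - z')" for y
        using norm_triangle_ineq4[of "f y - z'" "f y - z"] by (auto simp: indicator_def)
    qed auto
    also have "\<dots> = I k z + I k z'"
      unfolding I_def by (intro Bochner_Integration.integral_add) auto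
    finally show ?thesis .
  qed
  have int_const: "integrable lborel (\<lambda>y. indicator {0..<real (H k) * w k} y * cmod z)" for k z
    by (intro integrable_mult_left integrable_real_indicator) (auto simp: width_nonneg)
  have I_tri': "I k z \<le> I k z' + real (H k) * w k * cmod (z' - z)" for k z z'
  proof -
    have "I k z \<le> (LINT y|lborel. indicator {0..<real (H k) * w k} y * cmod (f y - z') + indicator {0..<real (H k) * w k} y * cmod (z' - z))"
      unfolding I_def
    proof (rule integral_mono')
      show "indicator {0..<real (H k) * w k} y * cmod (f y - z) \<le> indicator {0..<real (H k) * w k} y * cmod (f y - z') + indicator {0..<real (H k) * w k} y * cmod (z' - z)" for y
        using norm_triangle_ineq[of "f y - z'" "z' - z"] by (auto simp: indicator_def)
    qed (auto intro!: Bochner_Integration.integrable_add int_const)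
    also have "\<dots> = I k z' + (LINT y|lborel. indicator {0..<real (H k) * w k} y * cmod (z' - z))"
      unfolding I_def by (intro Bochner_Integration.integral_add integrable_base int_const)
    finally show ?thesis by (simp add: width_nonneg)
  qed
  have "\<exists>k z. n \<le> k \<and> I k z < inverse (real (Suc n))" for n
  proof -
    have "\<forall>\<^sub>F k in sequentially. n \<le> k \<and> (\<exists>z. I k z < inverse (real (Suc n)))"
      unfolding I by (intro eventually_conj eventually_ge_at_top base_almost_constant) simp
    then show ?thesis using eventually_happens'[OF sequentially_bot] by blast
  qed
  then obtain \<kappa> z where \<kappa>: "\<And>n. n \<le> \<kappa> n" and z: "\<And>n. I (\<kappa> n) (z n) < inverse (real (Suc n))"
    by metis
  have Iz: "I k (z n) < inverse (real (Suc n))" if "k \<le> n" for k n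
    using I_mono[of k "\<kappa> n" "z n"] \<kappa>[of n] z[of n] that by linarith
  have inv0: "(\<lambda>n. inverse (real (Suc n))) \<longlonglongrightarrow> 0" by (rule LIMSEQ_inverse_real_of_nat)
  have "Cauchy z"
  proof (rule metric_CauchyI)
    fix e :: real assume "0 < e"
    then obtain N where N: "inverse (real (Suc N)) < e / 2"
      using reals_Archimedean[of "e / 2"] by auto
    have "dist (z m) (z n) < e" if "N \<le> m" "N \<le> n" for m n
    proof -
      have "cmod (z m - z n) \<le> I 0 (z m) + I 0 (z n)"
        using I_tri[of 0 "z m" "z n"] by (simp add: width_0)
      moreover have "inverse (real (Suc m)) \<le> inverse (real (Suc N))" "inverse (real (Suc n)) \<le> inverse (real (Suc N))"
        using that by (auto intro!: le_imp_inverse_le)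
      ultimately show ?thesis
        unfolding dist_norm using Iz[of 0 m] Iz[of 0 n] N by linarith
    qed
    then show "\<exists>N. \<forall>m\<ge>N. \<forall>n\<ge>N. dist (z m) (z n) < e" by blast
  qed
  then obtain z0 where z0: "z \<longlonglongrightarrow> z0" using Cauchy_convergent convergent_def by blast
  have "I k z0 = 0" for k
  proof (rule antisym)
    have "(\<lambda>n. inverse (real (Suc n)) + real (H k) * w k * cmod (z n - z0)) \<longlonglongrightarrow> 0 + real (H k) * w k * cmod (z0 - z0)"
      by (intro tendsto_intros inv0 z0)
    moreover have "\<exists>N. \<forall>n\<ge>N. I k z0 \<le> inverse (real (Suc n)) + real (H k) * w k * cmod (z n - z0)"
      using I_tri'[of k z0] Iz[of k] by (intro exI[of _ k]) (smt (verit))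
    ultimately have "I k z0 \<le> 0 + real (H k) * w k * cmod (z0 - z0)"
      by (rule LIMSEQ_le_const)
    then show "I k z0 \<le> 0" by simp
    show "0 \<le> I k z0" unfolding I_def by (intro Bochner_Integration.integral_nonneg) auto
  qed
  then have "AE y in lborel. indicator {0..<real (H k) * w k} y * cmod (f y - z0) = 0" for k
    unfolding I_def by (subst (asm) integral_nonneg_eq_0_iff_AE) auto
  then have "AE y in lborel. \<forall>k. indicator {0..<real (H k) * w k} y * cmod (f y - z0) = 0"
    by (intro AE_all_countable[THEN iffD2] allI)
  then have "AE y in lborel. y \<in> X \<longrightarrow> f y = z0"
  proof eventually_elim
    case (elim y)
    show ?case
    proof
      assume "y \<in> X"
      then obtain k where "y \<in> {0..<real (H k) * w k}" unfolding X_eq by blast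
      then show "f y = z0" using elim[rule_format, of k] by simp
    qed
  qed
  then show ?thesis by blast
qed

end

context finite_cutting_and_stacking
begin

text \<open>The Koopman operator is an isometry.\<close>

lemma koopman_eigenvalue_unimodular:
  assumes f: "koopman_eigenfunction \<mu> T l f"
  shows "cmod l = 1"
proof -
  have [measurable]: "f \<in> borel_measurable \<mu>" "T \<in> measurable \<mu> \<mu>"
    and int: "integrable \<mu> (\<lambda>x. (cmod (f x))\<^sup>2)"
    and nz: "\<not> (AE x in \<mu>. f x = 0)" and eig: "AE x in \<mu>. f (T x) = l * f x"
    using f measure_preserving_T unfolding koopman_eigenfunction_def measure_preserving_map_def by auto
  have "(LINT x|\<mu>. (cmod (f x))\<^sup>2) = (LINT x|distr \<mu> \<mu> T. (cmod (f x))\<^sup>2)"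
    using measure_preserving_T unfolding measure_preserving_map_def by simp
  also have "\<dots> = (LINT x|\<mu>. (cmod (f (T x)))\<^sup>2)"
    by (rule integral_distr) measurable
  also have "\<dots> = (LINT x|\<mu>. (cmod l)\<^sup>2 * (cmod (f x))\<^sup>2)"
    using eig by (intro integral_cong_AE) (auto simp: norm_mult power_mult_distrib)
  finally have "(LINT x|\<mu>. (cmod (f x))\<^sup>2) = (cmod l)\<^sup>2 * (LINT x|\<mu>. (cmod (f x))\<^sup>2)" by simp
  moreover have "(LINT x|\<mu>. (cmod (f x))\<^sup>2) \<noteq> 0"
    using nz int by (subst integral_nonneg_eq_0_iff_AE) auto
  ultimately have "(cmod l)\<^sup>2 = 1" by simp
  then show ?thesis using norm_ge_zero[of l] by (simp add: power2_eq_1_iff)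
qed

lemma koopman_eigenfunction_on_lineI:
  assumes f: "koopman_eigenfunction \<mu> T l f"
  shows "koopman_eigenfunction_on_line p a (\<lambda>x. indicator X x *\<^sub>R f x) l"
proof unfold_locales
  interpret prob_space \<mu> by (rule prob_space_\<mu>)
  have m: "f \<in> borel_measurable \<mu>" and int: "integrable \<mu> (\<lambda>x. (cmod (f x))\<^sup>2)"
    and eig: "AE x in \<mu>. f (T x) = l * f x"
    using f unfolding koopman_eigenfunction_def by auto
  have "integrable \<mu> (\<lambda>x. cmod (f x))"
    by (rule square_integrable_imp_integrable[OF measurable_compose[OF m borel_measurable_norm] int])
  then have "integrable \<mu> f" using m by (simp add: integrable_norm_iff)
  then show "complex_integrable lborel (\<lambda>x. indicator X x *\<^sub>R f x)" by (rule integrable_\<mu>)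
  show "cmod l = 1" by (rule koopman_eigenvalue_unimodular[OF f])
  have "AE y in lborel. y \<in> X \<longrightarrow> f (T y) = l * f y" using eig unfolding AE_\<mu> .
  then show "AE y in lborel. y \<in> X \<longrightarrow> indicator X (T y) *\<^sub>R f (T y) = l * (indicator X y *\<^sub>R f y)"
    by eventually_elim (auto simp: T_in_X)
qed simp

text \<open>The powers of every eigenvalue along the return times \<open>H k + a k 1\<close> tend to 1, so
  that \<open>rigid\<close> leaves 1 as the only eigenvalue; its eigenfunctions are constant for every
  transformation of this kind.\<close>

lemma weakly_mixing_criterion:
  assumes ratio: "\<And>k. real (H (Suc k)) \<le> R * real (H k)"
    and rigid: "\<And>l. cmod l = 1 \<Longrightarrow> (\<lambda>k. l ^ (H k + a k 1)) \<longlonglongrightarrow> 1 \<Longrightarrow> l = 1"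
  shows "weakly_mixing \<mu> T"
  unfolding weakly_mixing_def
proof (intro conjI prob_space_\<mu> measure_preserving_T allI impI)
  interpret P: prob_space \<mu> by (rule prob_space_\<mu>)
  have "koopman_eigenfunction \<mu> T 1 (\<lambda>_. 1)"
    unfolding koopman_eigenfunction_def by simp
  moreover have "l = 1" if l: "koopman_eigenvalue \<mu> T l" for l
  proof -
    obtain f where f: "koopman_eigenfunction \<mu> T l f" using l unfolding koopman_eigenvalue_def by blast
    interpret koopman_eigenfunction_on_line p a "\<lambda>x. indicator X x *\<^sub>R f x" l
      by (rule koopman_eigenfunction_on_lineI[OF f])
    have "\<not> (AE x in \<mu>. f x = 0)" using f unfolding koopman_eigenfunction_def by simp
    then have "\<not> (AE y in lborel. indicator X y *\<^sub>R f y = 0)"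
      unfolding AE_\<mu> by (auto elim!: eventually_mono simp: indicator_def split: if_splits)
    then show "l = 1"
      using rigid[OF l_unimodular] eigenvalue_power_tendsto_1[OF ratio] by blast
  qed
  ultimately show "{l. koopman_eigenvalue \<mu> T l} = {1}"
    unfolding koopman_eigenvalue_def by blast
  fix f assume f: "koopman_eigenfunction \<mu> T 1 f"
  interpret koopman_eigenfunction_on_line p a "\<lambda>x. indicator X x *\<^sub>R f x" 1
    by (rule koopman_eigenfunction_on_lineI[OF f])
  obtain z where "AE y in lborel. y \<in> X \<longrightarrow> indicator X y *\<^sub>R f y = z"
    using invariant_constant by blast
  then have "AE x in \<mu>. f x = z"
    unfolding AE_\<mu> by (auto elim!: eventually_mono)
  then show "\<exists>z. AE x in \<mu>. f x = z" by blast
qed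

end


section \<open>Frequencies close to integers along the return times\<close>

definition near_int :: "real \<Rightarrow> real \<Rightarrow> bool" where
  "near_int e y \<longleftrightarrow> (\<exists>n::int. \<bar>y - of_int n\<bar> < e)"

text \<open>The continuous branch of the logarithm at 1 recovers \<open>2 * pi\<close> times the distance of
  \<open>y k\<close> to the nearest integer.\<close>

lemma cis_tendsto_1_near_int:
  assumes lim: "(\<lambda>k. cis (2 * pi * y k)) \<longlonglongrightarrow> 1" and e: "0 < e"
  shows "\<forall>\<^sub>F k in sequentially. near_int e (y k)"
proof -
  have "(\<lambda>k. Ln (cis (2 * pi * y k))) \<longlonglongrightarrow> Ln 1"
    using lim by (intro tendsto_Ln) auto
  then have "(\<lambda>k. cmod (Ln (cis (2 * pi * y k)))) \<longlonglongrightarrow> 0"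
    by (auto intro: tendsto_norm_zero)
  then have "\<forall>\<^sub>F k in sequentially. cmod (Ln (cis (2 * pi * y k))) < 2 * pi * e"
    using e by (intro order_tendstoD) auto
  then show ?thesis
  proof eventually_elim
    case (elim k)
    have "exp (Ln (cis (2 * pi * y k))) = exp (\<i> * of_real (2 * pi * y k))"
      by (subst exp_Ln) (auto simp: cis_conv_exp)
    then obtain n :: int where n: "Ln (cis (2 * pi * y k)) = \<i> * of_real (2 * pi * y k) + (of_int (2 * n) * pi) * \<i>"
      unfolding exp_eq by blast
    have "Ln (cis (2 * pi * y k)) = \<i> * of_real (2 * pi * (y k - of_int (- n)))"
      unfolding n by (simp add: algebra_simps)
    then have "cmod (Ln (cis (2 * pi * y k))) = 2 * pi * \<bar>y k - of_int (- n)\<bar>"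
      by (simp only: norm_mult norm_of_real abs_mult norm_ii) simp
    then have "\<bar>y k - of_int (- n)\<bar> < e"
      using elim by simp
    then show ?case unfolding near_int_def by blast
  qed
qed

text \<open>\<open>G\<close> and its shift by 1 are disjoint subsets of an interval with
  \<open>2 t + 2\<close> elements.\<close>

lemma card_no_two_consecutive:
  assumes G: "G \<subseteq> {- int t..int t}" and gap: "\<And>y. y \<in> G \<Longrightarrow> y + 1 \<notin> G"
  shows "card G \<le> t + 1"
proof -
  have fin: "finite G" using G by (rule finite_subset) simp
  have "card G + card ((\<lambda>y. y + 1) ` G) = card (G \<union> (\<lambda>y. y + 1) ` G)"
    using fin gap by (intro card_Un_disjoint[symmetric]) auto
  also have "\<dots> \<le> card {- int t..int t + 1}"
    using G by (intro card_mono) auto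
  finally show ?thesis by (simp add: card_image)
qed

text \<open>The assumption \<open>e_small\<close> forces the frequencies of a narrow interval to share the integer
  near their product with the next return time.\<close>

locale approximate_frequencies =
  fixes t h :: "nat \<Rightarrow> nat" and R e :: real
  assumes h_pos: "\<And>k. 0 < h k"
    and ratio: "\<And>k. real (h (Suc k) + 3 * t (Suc k)) \<le> R * real (h k)"
    and e_pos: "0 < e"
    and e_small: "(2 + 2 * R) * e < 1"
begin

text \<open>\<open>h k + 2 * t k + v k\<close> is the return time \<open>m\<^sub>k\<close> when the random coordinate has the value \<open>v k\<close>.\<close>

definition survives :: "nat \<Rightarrow> (nat \<Rightarrow> int) \<Rightarrow> real \<Rightarrow> bool" where
  "survives k v \<theta> \<longleftrightarrow> near_int e (\<theta> * of_int (int (h k) + 2 * int (t k) + v k))"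

text \<open>A set of frequencies that stays away from the integers and is as narrow as the condition at
  stage \<open>k\<close> can make it.\<close>

definition tight :: "nat \<Rightarrow> real set \<Rightarrow> bool" where
  "tight k J \<longleftrightarrow> (\<forall>\<theta>\<in>J. \<not> near_int ((2 + 2 * R) * e) \<theta>) \<and>
     (\<forall>\<theta>\<in>J. \<forall>\<theta>'\<in>J. \<bar>\<theta> - \<theta>'\<bar> * real (h k) \<le> 2 * e)"

text \<open>The next return time is at most \<open>R * h k\<close>, so it magnifies the width
  \<open>2 * e / h k\<close> of \<open>J\<close> to at most \<open>2 * R * e\<close>.\<close>

lemma tight_diff:
  assumes J: "tight k J" "\<theta> \<in> J" "\<theta>' \<in> J" and y: "- int (t (Suc k)) \<le> y" "y \<le> int (t (Suc k))"
  shows "\<bar>(\<theta> - \<theta>') * of_int (int (h (Suc k)) + 2 * int (t (Suc k)) + y)\<bar> \<le> 2 * R * e"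
proof -
  have "\<bar>(\<theta> - \<theta>') * of_int (int (h (Suc k)) + 2 * int (t (Suc k)) + y)\<bar> =
    \<bar>\<theta> - \<theta>'\<bar> * of_int (int (h (Suc k)) + 2 * int (t (Suc k)) + y)"
    using y by (simp add: abs_mult)
  also have "\<dots> \<le> \<bar>\<theta> - \<theta>'\<bar> * (R * real (h k))"
    using ratio[of k] y by (intro mult_left_mono) (auto intro: order_trans[rotated])
  also have "\<dots> = R * (\<bar>\<theta> - \<theta>'\<bar> * real (h k))" by simp
  also have "\<dots> \<le> R * (2 * e)"
  proof (rule mult_left_mono)
    show "\<bar>\<theta> - \<theta>'\<bar> * real (h k) \<le> 2 * e" using J unfolding tight_def by blast
    have "0 \<le> R * real (h k)" using ratio[of k] by (rule order_trans[rotated]) simp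
    then show "0 \<le> R" using h_pos[of k] by (simp add: zero_le_mult_iff)
  qed
  finally show ?thesis by simp
qed

text \<open>The products of the surviving frequencies with the next return time lie within
  \<open>2 R e\<close> of each other, so they are near the same integer. This determines the frequencies with
  the precision of the next stage: one interval never splits into several.\<close>

lemma tight_step:
  assumes J: "tight k J" and y: "- int (t (Suc k)) \<le> y" "y \<le> int (t (Suc k))"
  shows "tight (Suc k) {\<theta>\<in>J. near_int e (\<theta> * of_int (int (h (Suc k)) + 2 * int (t (Suc k)) + y))}"
proof -
  define m where "m = int (h (Suc k)) + 2 * int (t (Suc k)) + y"
  have m: "real (h (Suc k)) \<le> of_int m" using y unfolding m_def by linarith
  have "\<bar>\<theta> - \<theta>'\<bar> * real (h (Suc k)) \<le> 2 * e"
    if t: "\<theta> \<in> J" "\<theta>' \<in> J" "near_int e (\<theta> * of_int m)" "near_int e (\<theta>' * of_int m)" for \<theta> \<theta>'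
  proof -
    obtain n n' :: int where n: "\<bar>\<theta> * of_int m - of_int n\<bar> < e" "\<bar>\<theta>' * of_int m - of_int n'\<bar> < e"
      using t unfolding near_int_def by blast
    have "\<bar>\<theta> * of_int m - \<theta>' * of_int m\<bar> \<le> 2 * R * e"
      using tight_diff[OF J t(1,2) y] unfolding m_def[symmetric] by (simp add: algebra_simps)
    then have "\<bar>of_int n - of_int n'\<bar> < (1::real)"
      using n e_small by (simp add: algebra_simps)
    then have "n = n'" by linarith
    then have "\<bar>\<theta> * of_int m - \<theta>' * of_int m\<bar> \<le> 2 * e" using n by linarith
    then have "\<bar>\<theta> - \<theta>'\<bar> * of_int m \<le> 2 * e"
      using m by (simp add: abs_mult flip: left_diff_distrib)
    moreover have "\<bar>\<theta> - \<theta>'\<bar> * real (h (Suc k)) \<le> \<bar>\<theta> - \<theta>'\<bar> * of_int m"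
      using m by (intro mult_left_mono) auto
    ultimately show ?thesis by linarith
  qed
  then show ?thesis
    using J unfolding tight_def m_def[symmetric] by auto
qed

text \<open>If \<open>y\<close> and \<open>y + 1\<close> were both compatible with \<open>J\<close>,
  subtracting the two return times would put a frequency of \<open>J\<close> itself near an integer.\<close>

lemma few_survivors_step:
  assumes J: "tight k J"
  defines "G \<equiv> {y \<in> {- int (t (Suc k))..int (t (Suc k))}.
      \<exists>\<theta>\<in>J. near_int e (\<theta> * of_int (int (h (Suc k)) + 2 * int (t (Suc k)) + y))}"
  shows "card G \<le> t (Suc k) + 1"
proof (rule card_no_two_consecutive)
  show "G \<subseteq> {- int (t (Suc k))..int (t (Suc k))}" unfolding G_def by auto
  fix y assume y: "y \<in> G"
  show "y + 1 \<notin> G"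
  proof
    assume y1: "y + 1 \<in> G"
    define m where "m = int (h (Suc k)) + 2 * int (t (Suc k)) + y"
    obtain \<theta> n where t: "\<theta> \<in> J" "\<bar>\<theta> * of_int m - of_int n\<bar> < e"
      using y unfolding G_def m_def near_int_def by auto
    obtain \<theta>' n' where t': "\<theta>' \<in> J" "\<bar>\<theta>' * of_int (m + 1) - of_int n'\<bar> < e"
      using y1 unfolding G_def m_def near_int_def by (auto simp: add.assoc)
    have "\<bar>(\<theta> - \<theta>') * of_int m\<bar> \<le> 2 * R * e"
      using tight_diff[OF J t(1) t'(1), of y] y unfolding G_def m_def by auto
    then have "\<bar>\<theta>' - of_int (n' - n)\<bar> < (2 + 2 * R) * e"
      using t(2) t'(2) by (simp add: algebra_simps)
    then have "near_int ((2 + 2 * R) * e) \<theta>'" unfolding near_int_def by blast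
    then show False using J t'(1) unfolding tight_def by blast
  qed
qed

text \<open>Fixing the first choice replaces \<open>J\<close> by a set that is tight at the next stage, so
  that the bound of the single step multiplies.\<close>

lemma few_survivors:
  assumes "tight k J"
  shows "card {v \<in> (\<Pi>\<^sub>E j\<in>{k<..k + n}. {- int (t j)..int (t j)}). \<exists>\<theta>\<in>J. \<forall>j\<in>{k<..k + n}. survives j v \<theta>}
    \<le> (\<Prod>j\<in>{k<..k + n}. t j + 1)"
  using assms
proof (induction n arbitrary: k J)
  case 0
  have "{v \<in> (\<Pi>\<^sub>E j\<in>{k<..k + 0}. {- int (t j)..int (t j)}). \<exists>\<theta>\<in>J. \<forall>j\<in>{k<..k + 0}. survives j v \<theta>} \<subseteq> {\<lambda>_. undefined}"
    by auto
  from card_mono[OF _ this] show ?case by simp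
next
  case (Suc n)
  let ?I = "{k<..k + Suc n}" and ?I' = "{Suc k<..Suc k + n}"
  let ?X = "\<lambda>j. {- int (t j)..int (t j)}"
  define V where "V = {v \<in> (\<Pi>\<^sub>E j\<in>?I. ?X j). \<exists>\<theta>\<in>J. \<forall>j\<in>?I. survives j v \<theta>}"
  define J' where "J' y = {\<theta>\<in>J. near_int e (\<theta> * of_int (int (h (Suc k)) + 2 * int (t (Suc k)) + y))}" for y
  define V' where "V' y = {v \<in> (\<Pi>\<^sub>E j\<in>?I'. ?X j). \<exists>\<theta>\<in>J' y. \<forall>j\<in>?I'. survives j v \<theta>}" for y
  define G where "G = {y \<in> ?X (Suc k). \<exists>\<theta>\<in>J. near_int e (\<theta> * of_int (int (h (Suc k)) + 2 * int (t (Suc k)) + y))}"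
  have I: "?I = insert (Suc k) ?I'" "Suc k \<notin> ?I'" by auto
  have finV': "finite (V' y)" for y
    unfolding V'_def by (rule finite_subset[of _ "\<Pi>\<^sub>E j\<in>?I'. ?X j"]) (auto intro!: finite_PiE)
  have finG: "finite G" unfolding G_def by (rule finite_subset[of _ "?X (Suc k)"]) auto
  have "V \<subseteq> (\<Union>y\<in>G. (\<lambda>v. v(Suc k := y)) ` V' y)"
  proof
    fix v assume "v \<in> V"
    then obtain \<theta> where v: "v \<in> (\<Pi>\<^sub>E j\<in>?I. ?X j)" and th: "\<theta> \<in> J" "\<forall>j\<in>?I. survives j v \<theta>"
      unfolding V_def by blast
    define v' where "v' = v(Suc k := undefined)"
    have "v' \<in> (\<Pi>\<^sub>E j\<in>?I'. ?X j)"
      using v unfolding v'_def I(1) by (auto simp: PiE_iff extensional_def)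
    moreover have "\<theta> \<in> J' (v (Suc k))"
      using th unfolding J'_def I(1) by (auto simp: survives_def)
    moreover have "\<forall>j\<in>?I'. survives j v' \<theta>"
      using th(2) unfolding v'_def survives_def I(1) by auto
    ultimately have "v' \<in> V' (v (Suc k))" unfolding V'_def by blast
    moreover have "v = v'(Suc k := v (Suc k))" unfolding v'_def by auto
    moreover have "v (Suc k) \<in> G"
      using v th unfolding G_def I(1) by (auto simp: survives_def)
    ultimately show "v \<in> (\<Union>y\<in>G. (\<lambda>v. v(Suc k := y)) ` V' y)" by blast
  qed
  then have "card V \<le> card (\<Union>y\<in>G. (\<lambda>v. v(Suc k := y)) ` V' y)"
    by (intro card_mono) (auto simp: finG finV')
  also have "\<dots> \<le> (\<Sum>y\<in>G. card ((\<lambda>v. v(Suc k := y)) ` V' y))"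
    by (rule card_UN_le[OF finG])
  also have "\<dots> \<le> (\<Sum>y\<in>G. \<Prod>j\<in>?I'. t j + 1)"
  proof (rule sum_mono)
    fix y assume "y \<in> G"
    then have y: "- int (t (Suc k)) \<le> y" "y \<le> int (t (Suc k))" unfolding G_def by auto
    have "card ((\<lambda>v. v(Suc k := y)) ` V' y) \<le> card (V' y)" by (rule card_image_le[OF finV'])
    also have "\<dots> \<le> (\<Prod>j\<in>?I'. t j + 1)"
      unfolding V'_def J'_def by (rule Suc.IH[OF tight_step[OF Suc.prems y]])
    finally show "card ((\<lambda>v. v(Suc k := y)) ` V' y) \<le> (\<Prod>j\<in>?I'. t j + 1)" .
  qed
  also have "\<dots> = card G * (\<Prod>j\<in>?I'. t j + 1)" by simp
  also have "\<dots> \<le> (t (Suc k) + 1) * (\<Prod>j\<in>?I'. t j + 1)"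
    unfolding G_def by (rule mult_right_mono[OF few_survivors_step[OF Suc.prems]]) simp
  also have "\<dots> = (\<Prod>j\<in>?I. t j + 1)" unfolding I(1) using I(2) by (subst prod.insert) auto
  finally show ?case unfolding V_def .
qed

end


section \<open>Almost surely no frequency survives\<close>

text \<open>The coordinates with second index 1 are independent and uniform; they are the only ones on which
  the return times \<open>H k + a k 1\<close> depend.\<close>

lemma ornstein_cylinder:
  assumes p: "\<And>k. 2 \<le> p k" and F: "finite F" "F \<subseteq> {1..}" and v: "\<And>j. j \<in> F \<Longrightarrow> v j \<in> {- int (t j)..int (t j)}"
  shows "{\<omega> \<in> space (ornstein_space p t). \<forall>j\<in>F. \<omega> j 1 = v j} \<in> sets (ornstein_space p t)"
    and "measure (ornstein_space p t) {\<omega> \<in> space (ornstein_space p t). \<forall>j\<in>F. \<omega> j 1 = v j} = (\<Prod>j\<in>F. 1 / (2 * real (t j) + 1))"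
proof -
  let ?U = "\<lambda>k. uniform_count_measure {- int (t k)..int (t k)}"
  let ?M = "\<lambda>k. \<Pi>\<^sub>M l\<in>{1..p k - 1}. ?U k"
  have U: "prob_space (?U k)" for k
    by (rule prob_space_uniform_count_measure) auto
  interpret I: product_prob_space "\<lambda>l. ?U k" "{1..p k - 1}" for k
    by (intro product_prob_spaceI U)
  interpret O: product_prob_space ?M "{1..}"
    by (intro product_prob_spaceI prob_space_PiM U)
  let ?X = "\<lambda>j. {g \<in> space (?M j). g 1 \<in> {v j}}"
  have one: "1 \<in> {1..p j - 1}" for j using p[of j] by simp
  have vs: "{v j} \<in> sets (?U j)" if "j \<in> F" for j
    using v[OF that] by (auto simp: sets_uniform_count_measure)
  have Xs: "?X j \<in> sets (?M j)" if "j \<in> F" for j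
    using measurable_sets[OF measurable_component_singleton[OF one] vs[OF that]]
    by (simp add: vimage_def Int_def conj_commute)
  have Xe: "emeasure (?M j) (?X j) = 1 / (2 * real (t j) + 1)" if "j \<in> F" for j
  proof -
    have "emeasure (?M j) (?X j) = emeasure (?U j) {v j}"
      by (rule I.emeasure_PiM_Collect_single[OF one vs[OF that]])
    also have "\<dots> = 1 / (2 * real (t j) + 1)"
      using v[OF that] by (subst emeasure_uniform_count_measure) (auto simp: algebra_simps)
    finally show ?thesis .
  qed
  have eq: "{\<omega> \<in> space (ornstein_space p t). \<forall>j\<in>F. \<omega> j 1 = v j} =
    {\<omega> \<in> space (\<Pi>\<^sub>M k\<in>{1..}. ?M k). \<forall>j\<in>F. \<omega> j \<in> ?X j}"
    using F(2) unfolding ornstein_space_def by (auto simp: space_PiM PiE_iff)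
  show "{\<omega> \<in> space (ornstein_space p t). \<forall>j\<in>F. \<omega> j 1 = v j} \<in> sets (ornstein_space p t)"
  proof -
    have "{\<omega> \<in> space (\<Pi>\<^sub>M k\<in>{1..}. ?M k). \<omega> j \<in> ?X j} \<in> sets (\<Pi>\<^sub>M k\<in>{1..}. ?M k)" if "j \<in> F" for j
    proof -
      have "(\<lambda>\<omega>. \<omega> j) \<in> measurable (\<Pi>\<^sub>M k\<in>{1..}. ?M k) (?M j)"
        using that F by (intro measurable_component_singleton) auto
      from measurable_sets[OF this Xs[OF that]] show ?thesis
        by (simp add: vimage_def Int_def conj_commute)
    qed
    then show ?thesis
      unfolding eq unfolding ornstein_space_def using F(1) by (intro sets.sets_Collect_finite_All)
  qed
  have "emeasure (ornstein_space p t) {\<omega> \<in> space (ornstein_space p t). \<forall>j\<in>F. \<omega> j 1 = v j} =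
    (\<Prod>j\<in>F. emeasure (?M j) (?X j))"
    unfolding eq unfolding ornstein_space_def by (rule O.emeasure_PiM_Collect[OF F(2,1) Xs])
  also have "\<dots> = (\<Prod>j\<in>F. ennreal (1 / (2 * real (t j) + 1)))"
    using Xe by (intro prod.cong) auto
  also have "\<dots> = ennreal (\<Prod>j\<in>F. 1 / (2 * real (t j) + 1))"
    by (rule prod_ennreal) simp
  finally show "measure (ornstein_space p t) {\<omega> \<in> space (ornstein_space p t). \<forall>j\<in>F. \<omega> j 1 = v j} = (\<Prod>j\<in>F. 1 / (2 * real (t j) + 1))"
    by (simp add: measure_def prod_nonneg)
qed

text \<open>The exceptional event need not be measurable, since it quantifies over uncountably many
  frequencies; it is covered by measurable sets of small measure.\<close>

lemma AE_not_in_small_sets: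
  assumes "\<And>n. E n \<in> sets M" "\<And>n. emeasure M (E n) \<le> ennreal (r n)" "r \<longlonglongrightarrow> 0"
    and "\<And>\<omega> n. \<omega> \<in> space M \<Longrightarrow> P \<omega> \<Longrightarrow> \<omega> \<in> E n"
  shows "AE \<omega> in M. \<not> P \<omega>"
proof (rule AE_I)
  show "{\<omega> \<in> space M. \<not> \<not> P \<omega>} \<subseteq> (\<Inter>n. E n)" using assms(4) by auto
  show "(\<Inter>n. E n) \<in> sets M" using assms(1) by auto
  have "emeasure M (\<Inter>n. E n) \<le> ennreal (r m)" for m
    using assms(1,2)[of m] by (intro order_trans[OF emeasure_mono assms(2)]) auto
  moreover have "(\<lambda>m. ennreal (r m)) \<longlonglongrightarrow> ennreal 0"
    by (rule tendsto_ennrealI[OF assms(3)])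
  ultimately have "emeasure M (\<Inter>n. E n) \<le> ennreal 0"
    by (intro LIMSEQ_le_const) auto
  then show "emeasure M (\<Inter>n. E n) = 0" by simp
qed

context approximate_frequencies
begin

text \<open>At most \<open>t + 1\<close> of the \<open>2 t + 1\<close> equally likely values survive at each
  stage, and this proportion is at most \<open>2 / 3\<close> since \<open>t\<close> is at least 1.\<close>

lemma AE_tight_dies:
  assumes p: "\<And>k. 2 \<le> p k" and t: "\<And>k. 1 \<le> k \<Longrightarrow> 0 < t k" and J: "tight k J"
  shows "AE \<omega> in ornstein_space p t. \<not> (\<exists>\<theta>\<in>J. \<forall>j>k. survives j (\<lambda>i. \<omega> i 1) \<theta>)"
proof -
  let ?\<Omega> = "ornstein_space p t"
  define V where "V n = {v \<in> (\<Pi>\<^sub>E j\<in>{k<..k + n}. {- int (t j)..int (t j)}). \<exists>\<theta>\<in>J. \<forall>j\<in>{k<..k + n}. survives j v \<theta>}" for n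
  define C where "C n v = {\<omega> \<in> space ?\<Omega>. \<forall>j\<in>{k<..k + n}. \<omega> j 1 = v j}" for n v
  have finV: "finite (V n)" for n
    unfolding V_def by (rule finite_subset[of _ "\<Pi>\<^sub>E j\<in>{k<..k + n}. {- int (t j)..int (t j)}"]) (auto intro!: finite_PiE)
  have C: "C n v \<in> sets ?\<Omega>" "measure ?\<Omega> (C n v) = (\<Prod>j\<in>{k<..k + n}. 1 / (2 * real (t j) + 1))" if "v \<in> V n" for n v
  proof -
    have v: "v j \<in> {- int (t j)..int (t j)}" if "j \<in> {k<..k + n}" for j
      using \<open>v \<in> V n\<close> that unfolding V_def by (auto simp: PiE_iff)
    have F: "finite {k<..k + n}" "{k<..k + n} \<subseteq> {1..}" by auto
    show "C n v \<in> sets ?\<Omega>" "measure ?\<Omega> (C n v) = (\<Prod>j\<in>{k<..k + n}. 1 / (2 * real (t j) + 1))"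
      unfolding C_def using ornstein_cylinder[of p, OF p F v] by auto
  qed
  interpret prob_space ?\<Omega>
    unfolding ornstein_space_def by (intro prob_space_PiM prob_space_uniform_count_measure) auto
  show ?thesis
  proof (rule AE_not_in_small_sets)
    show "(\<Union>v\<in>V n. C n v) \<in> sets ?\<Omega>" for n using C finV by auto
    show "emeasure ?\<Omega> (\<Union>v\<in>V n. C n v) \<le> ennreal ((2 / 3) ^ n)" for n
    proof -
      have "prob (\<Union>v\<in>V n. C n v) \<le> (\<Sum>v\<in>V n. prob (C n v))"
        using C finV by (intro finite_measure_subadditive_finite) auto
      also have "\<dots> = real (card (V n)) * (\<Prod>j\<in>{k<..k + n}. 1 / (2 * real (t j) + 1))"
        using C by simp
      also have "\<dots> \<le> real (\<Prod>j\<in>{k<..k + n}. t j + 1) * (\<Prod>j\<in>{k<..k + n}. 1 / (2 * real (t j) + 1))"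
        using few_survivors[OF J, of n] unfolding V_def
        by (intro mult_right_mono prod_nonneg) (simp_all only: of_nat_le_iff, auto)
      also have "\<dots> = (\<Prod>j\<in>{k<..k + n}. (real (t j) + 1) / (2 * real (t j) + 1))"
        by (simp add: add.commute flip: prod.distrib)
      also have "\<dots> \<le> (\<Prod>j\<in>{k<..k + n}. 2 / 3)"
      proof (rule prod_mono)
        fix j assume "j \<in> {k<..k + n}"
        then have "0 < t j" using t[of j] by auto
        then show "0 \<le> (real (t j) + 1) / (2 * real (t j) + 1) \<and> (real (t j) + 1) / (2 * real (t j) + 1) \<le> 2 / 3"
          by (auto simp: divide_simps)
      qed
      finally show ?thesis by (simp add: emeasure_eq_measure)
    qed
    show "(\<lambda>n. (2 / 3) ^ n :: real) \<longlonglongrightarrow> 0" by (rule LIMSEQ_power_zero) simp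
    fix \<omega> n assume w: "\<omega> \<in> space ?\<Omega>" and "\<exists>\<theta>\<in>J. \<forall>j>k. survives j (\<lambda>i. \<omega> i 1) \<theta>"
    then obtain \<theta> where th: "\<theta> \<in> J" "\<forall>j>k. survives j (\<lambda>i. \<omega> i 1) \<theta>" by blast
    define v where "v = restrict (\<lambda>j. \<omega> j 1) {k<..k + n}"
    have "v \<in> V n"
      unfolding V_def
    proof (intro CollectI conjI bexI[of _ \<theta>] ballI th(1))
      show "v \<in> (\<Pi>\<^sub>E j\<in>{k<..k + n}. {- int (t j)..int (t j)})"
        unfolding v_def
      proof (rule restrict_PiE_iff[THEN iffD2], rule ballI)
        fix j assume "j \<in> {k<..k + n}"
        then show "\<omega> j 1 \<in> {- int (t j)..int (t j)}"
          using p[of j] by (intro ornstein_space_bound[OF w]) auto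
      qed
      show "survives j v \<theta>" if "j \<in> {k<..k + n}" for j
        using th(2) that unfolding v_def survives_def by auto
    qed
    moreover have "\<omega> \<in> C n v" using w unfolding C_def v_def by auto
    ultimately show "\<omega> \<in> (\<Union>v\<in>V n. C n v)" by blast
  qed
qed

text \<open>For each stage \<open>k\<close>, the frequencies in the unit interval that stay away from the
  integers are covered by countably many tight sets.\<close>

lemma AE_no_frequency_survives:
  assumes p: "\<And>k. 2 \<le> p k" and t: "\<And>k. 1 \<le> k \<Longrightarrow> 0 < t k"
  shows "AE \<omega> in ornstein_space p t. \<forall>k. \<forall>\<theta>\<in>{0..1}. (\<forall>j>k. survives j (\<lambda>i. \<omega> i 1) \<theta>) \<longrightarrow> near_int ((2 + 2 * R) * e) \<theta>"
proof -
  \<comment> \<open>Each set lies in an interval of length \<open>2 * e / h k\<close>.\<close>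
  define J where "J k i = {\<theta>. \<theta> * real (h k) / (2 * e) \<in> {real i..real i + 1} \<and> \<not> near_int ((2 + 2 * R) * e) \<theta>}" for k i
  have "tight k (J k i)" for k i
    unfolding tight_def
  proof (intro conjI ballI)
    fix \<theta> \<theta>' assume "\<theta> \<in> J k i" "\<theta>' \<in> J k i"
    then have "\<bar>\<theta> * real (h k) / (2 * e) - \<theta>' * real (h k) / (2 * e)\<bar> \<le> 1" unfolding J_def by auto
    moreover have "\<bar>\<theta> * real (h k) / (2 * e) - \<theta>' * real (h k) / (2 * e)\<bar> = \<bar>\<theta> - \<theta>'\<bar> * real (h k) / (2 * e)"
      using e_pos by (simp add: abs_mult flip: left_diff_distrib diff_divide_distrib)
    ultimately show "\<bar>\<theta> - \<theta>'\<bar> * real (h k) \<le> 2 * e"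
      using e_pos by (simp add: divide_le_eq)
  qed (simp add: J_def)
  then have "AE \<omega> in ornstein_space p t. \<forall>k i. \<not> (\<exists>\<theta>\<in>J k i. \<forall>j>k. survives j (\<lambda>i. \<omega> i 1) \<theta>)"
    using AE_tight_dies[of p, OF p t] by (simp add: AE_all_countable)
  then show ?thesis
  proof eventually_elim
    case (elim \<omega>)
    show ?case
    proof (intro allI ballI impI, rule ccontr)
      fix k \<theta> assume th: "\<theta> \<in> {0..1::real}" "\<forall>j>k. survives j (\<lambda>i. \<omega> i 1) \<theta>" "\<not> near_int ((2 + 2 * R) * e) \<theta>"
      have "0 \<le> \<theta> * real (h k) / (2 * e)" using th e_pos by simp
      then have "\<theta> \<in> J k (nat \<lfloor>\<theta> * real (h k) / (2 * e)\<rfloor>)"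
        using th(3) unfolding J_def by (auto simp: of_nat_nat)
      then show False using elim th(2) by blast
    qed
  qed
qed

end


section \<open>Ornstein transformations\<close>

lemma integer_if_always_near_int:
  assumes \<theta>: "0 \<le> \<theta>" "\<theta> < 1" and near: "\<And>q. near_int (1 / (real q + 2)) \<theta>"
  shows "\<theta> = 0"
proof (rule ccontr)
  assume "\<theta> \<noteq> 0"
  then have "0 < min \<theta> (1 - \<theta>)" using \<theta> by simp
  then obtain q where q: "inverse (real (Suc q)) < min \<theta> (1 - \<theta>)"
    using reals_Archimedean by blast
  have "1 / (real q + 2) \<le> inverse (real (Suc q))"
    by (simp add: divide_simps)
  moreover obtain n :: int where "\<bar>\<theta> - of_int n\<bar> < 1 / (real q + 2)"
    using near[of q] unfolding near_int_def by blast
  ultimately have n: "\<bar>\<theta> - of_int n\<bar> < min \<theta> (1 - \<theta>)"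
    using q by linarith
  have "n \<le> 0 \<or> 1 \<le> n" by linarith
  then have "of_int n \<le> (0::real) \<or> (1::real) \<le> of_int n" by simp
  then show False using n by linarith
qed

locale ornstein_parameters =
  fixes p a0 t x :: "nat \<Rightarrow> nat"
  assumes p_bdd: "bdd_above (range p)"
    and two_le_p: "\<And>k. 2 \<le> p k"
    and t_pos: "\<And>k. 1 \<le> k \<Longrightarrow> 0 < t k"
    and t_le: "\<And>k. 1 \<le> k \<Longrightarrow> 2 * t k \<le> ornstein_height p a0 t x k"
    and t_summable: "summable (\<lambda>k. real (t (Suc k)) / real (ornstein_height p a0 t x (Suc k)))"
    and x_summable: "summable (\<lambda>k. real (x (Suc k)) / (real (p (Suc k)) * real (ornstein_height p a0 t x (Suc k))))"
begin

abbreviation "h \<equiv> ornstein_height p a0 t x"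

lemma h_pos: "0 < h k"
proof (induction k rule: less_induct)
  case (less k)
  show ?case
  proof (cases k)
    case (Suc m)
    then have "0 < h m" "0 < p m" using less two_le_p[of m] by auto
    then show ?thesis using Suc by (cases m) auto
  qed simp
qed

text \<open>The term \<open>x k / (p k * h k)\<close> of a convergent series is bounded, \<open>p\<close> is
  bounded, and \<open>2 * t k \<le> h k\<close>.\<close>

lemma height_ratio_bounded: "\<exists>R > 0. \<forall>k. real (h (Suc k)) \<le> R * real (h k)"
proof -
  obtain P where P: "\<And>k. p k \<le> P" using p_bdd unfolding bdd_above_def by auto
  obtain B where B: "\<And>k. real (x (Suc k)) / (real (p (Suc k)) * real (h (Suc k))) \<le> B"
  proof -
    have "Bseq (\<lambda>k. real (x (Suc k)) / (real (p (Suc k)) * real (h (Suc k))))"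
      using summable_LIMSEQ_zero[OF x_summable] convergentI convergent_imp_Bseq by blast
    then obtain B where "\<And>k. norm (real (x (Suc k)) / (real (p (Suc k)) * real (h (Suc k)))) \<le> B"
      unfolding Bseq_def by auto
    then show thesis by (intro that[of B]) (auto intro: order_trans[OF abs_ge_self])
  qed
  \<comment> \<open>The second entry covers the first step, which follows a different recursion.\<close>
  define R where "R = max (real P * (2 + B)) (real (h 1))"
  have "real (h (Suc k)) \<le> R * real (h k)" for k
  proof (cases k)
    case 0
    then show ?thesis unfolding R_def by simp
  next
    case (Suc m)
    have pk: "0 < real (p k)" using two_le_p[of k] by simp
    have "0 \<le> real (x (Suc 0)) / (real (p (Suc 0)) * real (h (Suc 0)))"
      by (intro divide_nonneg_nonneg mult_nonneg_nonneg of_nat_0_le_iff)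
    then have B0: "0 \<le> B" using B[of 0] by (rule order_trans)
    have "real (x k) \<le> B * (real (p k) * real (h k))"
      using B[of m] h_pos[of k] pk unfolding Suc by (simp add: divide_le_eq)
    moreover have "2 * real (t k) \<le> real (h k)"
      using t_le[of k] Suc by (simp flip: of_nat_le_iff[where 'a = real])
    then have "real (p k) * (real (h k) + 2 * real (t k)) \<le> real (p k) * (2 * real (h k))"
      by (intro mult_left_mono) auto
    ultimately have "real (h (Suc k)) \<le> real (p k) * (2 + B) * real (h k)"
      unfolding Suc by (simp add: algebra_simps)
    also have "\<dots> \<le> R * real (h k)"
    proof (rule mult_right_mono)
      have "real (p k) * (2 + B) \<le> real P * (2 + B)" using P[of k] B0 by (intro mult_right_mono) auto
      then show "real (p k) * (2 + B) \<le> R" unfolding R_def by simp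
    qed simp
    finally show ?thesis .
  qed
  moreover have "0 < R" unfolding R_def using h_pos[of 1] by (simp only: less_max_iff_disj of_nat_0_less_iff simp_thms)
  ultimately show ?thesis by blast
qed

text \<open>Each step multiplies the total length of the stack by \<open>1 + u k\<close>, where
  \<open>u\<close> is summable. So the lengths are bounded by a multiple of \<open>exp (suminf u)\<close>, and
  the space has finite measure.\<close>

lemma towers_bounded: "bdd_above (range (\<lambda>k. real (h k) * level_width p k))"
proof -
  define u where "u k = 2 * (real (t (Suc k)) / real (h (Suc k))) + real (x (Suc k)) / (real (p (Suc k)) * real (h (Suc k)))" for k
  have u: "summable u" unfolding u_def by (intro summable_add summable_mult t_summable x_summable)
  have u0: "0 \<le> u k" for k unfolding u_def by simp
  define C where "C = real (h 1) * level_width p 1"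
  have w0: "0 < level_width p k" for k
    unfolding level_width_def using two_le_p by (auto intro!: prod_pos simp: less_le_trans[OF _ two_le_p])
  have C0: "0 \<le> C"
    unfolding C_def by (intro mult_nonneg_nonneg of_nat_0_le_iff less_imp_le w0)
  have le: "real (h (Suc k)) * level_width p (Suc k) \<le> C * exp (\<Sum>j<k. u j)" for k
  proof (induction k)
    case 0 show ?case by (simp add: C_def)
  next
    case (Suc k)
    let ?k = "Suc k"
    have pk: "0 < real (p ?k)" using two_le_p[of ?k] by simp
    have "H * P * (1 + (2 * (t' / H) + x' / (P * H))) = P * (H + 2 * t') + x'" if "0 < H" "0 < P" for H P t' x' :: real
      using that by (simp add: field_simps)
    from this[of "real (h ?k)" "real (p ?k)" "real (t ?k)" "real (x ?k)"]
    have area: "real (h (Suc ?k)) = real (h ?k) * real (p ?k) * (1 + u k)"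
      using pk h_pos[of ?k] by (simp add: u_def)
    have width: "level_width p ?k = real (p ?k) * level_width p (Suc ?k)"
      using pk by (simp add: level_width_def)
    have "real (h (Suc ?k)) * level_width p (Suc ?k) = real (h ?k) * level_width p ?k * (1 + u k)"
      unfolding area width by (simp only: mult_ac)
    also have "\<dots> \<le> (C * exp (\<Sum>j<k. u j)) * exp (u k)"
    proof (rule mult_mono[OF Suc.IH exp_ge_add_one_self])
      show "0 \<le> C * exp (\<Sum>j<k. u j)" using C0 by simp
      show "0 \<le> 1 + u k" using u0[of k] by simp
    qed
    also have "\<dots> = C * exp (\<Sum>j<?k. u j)" by (simp add: exp_add)
    finally show ?case .
  qed
  have bound: "real (h k) * level_width p k \<le> max 1 (C * exp (suminf u))" for k
  proof (cases k)
    case 0 then show ?thesis by (simp add: level_width_def)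
  next
    case (Suc m)
    have "C * exp (\<Sum>j<m. u j) \<le> C * exp (suminf u)"
      using sum_le_suminf[OF u, of "{..<m}"] u0 C0 by (intro mult_left_mono) auto
    then show ?thesis using le[of m] Suc by simp
  qed
  then show ?thesis by (intro bdd_aboveI2)
qed

text \<open>A frequency that survives for every precision \<open>e\<close> is an integer. Countably many
  precisions suffice, so the exceptional sets add up to a null set.\<close>

lemma AE_rigid:
  "AE \<omega> in ornstein_space p t. \<forall>l. cmod l = 1 \<longrightarrow>
    (\<lambda>k. l ^ (h k + ornstein_spacers p a0 t x \<omega> k 1)) \<longlonglongrightarrow> 1 \<longrightarrow> l = 1"
proof -
  obtain R0 where R0: "0 < R0" "\<And>k. real (h (Suc k)) \<le> R0 * real (h k)"
    using height_ratio_bounded by blast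
  \<comment> \<open>Since \<open>2 * t k \<le> h k\<close>, the return time is at most \<open>h k + 3 * t k \<le> 5 / 2 * h k\<close>.\<close>
  define R where "R = 5 / 2 * R0"
  have R: "0 < R" using R0 unfolding R_def by simp
  \<comment> \<open>The summand 2 makes \<open>(2 + 2 * R) * e q\<close> smaller than 1.\<close>
  define e where "e q = 1 / ((2 + 2 * R) * (real q + 2))" for q
  have e: "0 < e q" "(2 + 2 * R) * e q = 1 / (real q + 2)" for q
    using R unfolding e_def by auto
  have "AE \<omega> in ornstein_space p t. \<forall>k. \<forall>\<theta>\<in>{0..1}.
    (\<forall>j>k. near_int (e q) (\<theta> * of_int (int (h j) + 2 * int (t j) + \<omega> j 1))) \<longrightarrow> near_int (1 / (real q + 2)) \<theta>" for q
  proof -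
    interpret approximate_frequencies t h R "e q"
    proof
      show "0 < h k" for k by (rule h_pos)
      show "0 < e q" by (rule e)
      show "(2 + 2 * R) * e q < 1" unfolding e by simp
      show "real (h (Suc k) + 3 * t (Suc k)) \<le> R * real (h k)" for k
      proof -
        have "2 * real (t (Suc k)) \<le> real (h (Suc k))"
          using t_le[of "Suc k"] by (simp flip: of_nat_le_iff[where 'a = real])
        then show ?thesis using R0(2)[of k] unfolding R_def by simp
      qed
    qed
    show ?thesis
      using AE_no_frequency_survives[of p, OF two_le_p t_pos] unfolding survives_def e(2) .
  qed
  then have "AE \<omega> in ornstein_space p t. \<forall>q k. \<forall>\<theta>\<in>{0..1}.
    (\<forall>j>k. near_int (e q) (\<theta> * of_int (int (h j) + 2 * int (t j) + \<omega> j 1))) \<longrightarrow> near_int (1 / (real q + 2)) \<theta>"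
    by (simp add: AE_all_countable)
  then show ?thesis
  using AE_space[of "ornstein_space p t"]
  proof eventually_elim
    case (elim \<omega>)
    show ?case
    proof (intro allI impI)
      fix l :: complex
      assume l: "cmod l = 1" and lim: "(\<lambda>k. l ^ (h k + ornstein_spacers p a0 t x \<omega> k 1)) \<longlonglongrightarrow> 1"
      define \<theta> where "\<theta> = Arg2pi l / (2 * pi)"
      have \<theta>: "0 \<le> \<theta>" "\<theta> < 1"
        using Arg2pi_ge_0[of l] Arg2pi_lt_2pi[of l] unfolding \<theta>_def by auto
      have l\<theta>: "l = cis (2 * pi * \<theta>)"
        using Arg2pi_eq[of l] l unfolding \<theta>_def by (simp add: cis_conv_exp mult.commute)
      let ?m = "\<lambda>k. h k + ornstein_spacers p a0 t x \<omega> k 1"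
      have m: "real (?m k) = of_int (int (h k) + 2 * int (t k) + \<omega> k 1)" if "1 \<le> k" for k
      proof -
        have "int (ornstein_spacers p a0 t x \<omega> k 1) = 2 * int (t k) + \<omega> k 1"
          using ornstein_spacers_int[OF elim(2) that, of 1 a0 x] two_le_p[of k]
          by (simp add: ornstein_coord_def)
        then have "int (?m k) = int (h k) + 2 * int (t k) + \<omega> k 1" by simp
        then show ?thesis by (metis of_int_of_nat_eq)
      qed
      have "l ^ ?m k = cis (2 * pi * (\<theta> * real (?m k)))" for k
        unfolding l\<theta> Complex.DeMoivre by (simp add: mult_ac)
      with lim have lim': "(\<lambda>k. cis (2 * pi * (\<theta> * real (?m k)))) \<longlonglongrightarrow> 1" by simp
      have "near_int (1 / (real q + 2)) \<theta>" for q
      proof -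
        obtain k where k: "\<And>j. k \<le> j \<Longrightarrow> near_int (e q) (\<theta> * real (?m j))"
          using cis_tendsto_1_near_int[OF lim' e(1)[of q]] unfolding eventually_sequentially by blast
        have "\<forall>j>k. near_int (e q) (\<theta> * of_int (int (h j) + 2 * int (t j) + \<omega> j 1))"
        proof (intro allI impI)
          fix j assume "k < j"
          then have "1 \<le> j" "near_int (e q) (\<theta> * real (?m j))" using k[of j] by auto
          then show "near_int (e q) (\<theta> * of_int (int (h j) + 2 * int (t j) + \<omega> j 1))"
            by (simp only: m)
        qed
        then show ?thesis using elim(1) \<theta> by simp
      qed
      then have "\<theta> = 0" using integer_if_always_near_int \<theta> by blast
      then show "l = 1" using l\<theta> by simp
    qed
  qed
qed

lemma AE_weakly_mixing:
  "AE \<omega> in ornstein_space p t.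
    weakly_mixing (rank_one_measure p (ornstein_spacers p a0 t x \<omega>))
      (rank_one_map p (ornstein_spacers p a0 t x \<omega>))"
  using AE_rigid AE_space[of "ornstein_space p t"]
proof eventually_elim
  case (elim \<omega>)
  let ?a = "ornstein_spacers p a0 t x \<omega>"
  have len: "length (stack p ?a k) = h k" for k
    by (rule length_stack_ornstein[OF two_le_p elim(2)])
  interpret finite_cutting_and_stacking p ?a
    by unfold_locales (use two_le_p towers_bounded len in auto)
  obtain R where R: "\<And>k. real (h (Suc k)) \<le> R * real (h k)"
    using height_ratio_bounded by blast
  show ?case
    using R elim(1) by (intro weakly_mixing_criterion[of R]) (auto simp only: len)
qed

end

theorem theorem4p1:
  fixes p a0 t x h :: "nat \<Rightarrow> nat"
  defines "h \<equiv> ornstein_height p a0 t x"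
  assumes "bdd_above (range p)"
    and "\<And>k. p k \<ge> 2"
    and "\<And>k. k \<ge> 1 \<Longrightarrow> t k > 0"
    and "\<And>k. k \<ge> 1 \<Longrightarrow> x k > 0"
    and "\<And>k. k \<ge> 1 \<Longrightarrow> 2 * t k \<le> h k"
    and "summable (\<lambda>k. real (t (Suc k)) / real (h (Suc k)))"
    and "summable (\<lambda>k. real (x (Suc k)) / (real (p (Suc k)) * real (h (Suc k))))"
  shows "AE \<omega> in ornstein_space p t.
    weakly_mixing (rank_one_measure p (ornstein_spacers p a0 t x \<omega>))
      (rank_one_map p (ornstein_spacers p a0 t x \<omega>))"
proof -
  interpret ornstein_parameters p a0 t x
    using assms(2-) unfolding h_def by unfold_locales auto
  show ?thesis by (rule AE_weakly_mixing)
qed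

end
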